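(* Let $I$ be an infinite set of positive integers, let $c>0$ be a constant, and for each $n \in I$ let $H_n \le S_n$ be a subgroup with $|H_n| \le n^c$. Then the family $(S_n, H_n)_{n \in I}$ is distinguishable if and only if the minimal degrees are bounded, i.e. there is a constant $K$ such that $m(H_n) \le K$ for all sufficiently large $n \in I$.
   Context: For a finite group $G$, let $\mathrm{Irr}(G)$ be its set of complex irreducible characters and $d_\chi=\chi(e)$. For $H \le G$ let $D_H = \frac{1}{|G|}\sum_{\chi \in \mathrm{Irr}(G)} d_\chi \big|\sum_{h \in H, h \neq e}\chi(h)\big|$ (the $L_1$ distance between the distributions $P_H(\chi)=\frac{d_\chi}{|G|}\sum_{h\in H}\chi(h)$ and $P_{\{e\}}$ on $\mathrm{Irr}(G)$ produced by weak quantum Fourier sampling). Distinguishability is asymptotic: a family $(G_i,H_i)_{i \in I}$ with $H_i \le G_i$, $I$ an infinite set of positive integers and $|G_i| \to \infty$, is called distinguishable if there is a constant $c'>0$ such that $D_{H_i} \ge (\log|G_i|)^{-c'}$ for all sufficiently large $i \in I$, and indistinguishable otherwise. Here $S_n$ is the symmetric group on $\{1,\ldots,n\}$ (so $|S_n| = n!$). For $g \in S_n$, $\mathrm{supp}(g)$ is the number of points of $\{1,\dots,n\}$ moved by $g$. The minimal degree of $H \le S_n$ is $m(H) = \min\{\mathrm{supp}(h) : h \in H, h \neq e\}$, with the convention $m(\{e\}) = +\infty$. *)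

theory Defs
  imports "HOL-Algebra.Sym_Groups" "Jordan_Normal_Form.Matrix" "HOL-Library.Extended_Nat"
begin

definition is_rep :: "('g, 'b) monoid_scheme \<Rightarrow> nat \<Rightarrow> ('g \<Rightarrow> complex mat) \<Rightarrow> bool" where
  "is_rep G d \<rho> \<longleftrightarrow> d > 0 \<and>
     (\<forall>g\<in>carrier G. \<rho> g \<in> carrier_mat d d) \<and>
     (\<forall>g\<in>carrier G. \<forall>h\<in>carrier G. \<rho> (mult G g h) = \<rho> g * \<rho> h) \<and>
     \<rho> (one G) = 1\<^sub>m d"

definition is_subspace :: "nat \<Rightarrow> complex vec set \<Rightarrow> bool" where
  "is_subspace d W \<longleftrightarrow> W \<subseteq> carrier_vec d \<and> 0\<^sub>v d \<in> W \<and>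
     (\<forall>v\<in>W. \<forall>w\<in>W. v + w \<in> W) \<and> (\<forall>a. \<forall>v\<in>W. a \<cdot>\<^sub>v v \<in> W)"

definition is_irrep :: "('g, 'b) monoid_scheme \<Rightarrow> nat \<Rightarrow> ('g \<Rightarrow> complex mat) \<Rightarrow> bool" where
  "is_irrep G d \<rho> \<longleftrightarrow> is_rep G d \<rho> \<and>
     (\<forall>W. is_subspace d W \<and> (\<forall>g\<in>carrier G. \<forall>v\<in>W. \<rho> g *\<^sub>v v \<in> W)
          \<longrightarrow> W = {0\<^sub>v d} \<or> W = carrier_vec d)"

definition mat_trace :: "complex mat \<Rightarrow> complex" where
  "mat_trace A = (\<Sum>i<dim_row A. A $$ (i, i))"

definition Irr :: "('g, 'b) monoid_scheme \<Rightarrow> ('g \<Rightarrow> complex) set" where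
  "Irr G = {\<chi>. \<exists>d \<rho>. is_irrep G d \<rho> \<and>
                 \<chi> = (\<lambda>g. if g \<in> carrier G then mat_trace (\<rho> g) else 0)}"

definition char_deg :: "('g, 'b) monoid_scheme \<Rightarrow> ('g \<Rightarrow> complex) \<Rightarrow> real" where
  "char_deg G \<chi> = Re (\<chi> (one G))"

definition D_dist :: "('g, 'b) monoid_scheme \<Rightarrow> 'g set \<Rightarrow> real" where
  "D_dist G H = (1 / real (card (carrier G))) *
     (\<Sum>\<chi>\<in>Irr G. char_deg G \<chi> * cmod (\<Sum>h\<in>H - {one G}. \<chi> h))"

definition distinguishable_Sym :: "nat set \<Rightarrow> (nat \<Rightarrow> (nat \<Rightarrow> nat) set) \<Rightarrow> bool" where
  "distinguishable_Sym I H \<longleftrightarrow>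
     (\<exists>c'>0. \<exists>N. \<forall>n\<in>I. n \<ge> N \<longrightarrow>
        D_dist (sym_group n) (H n) \<ge> ln (real (card (carrier (sym_group n)))) powr (- c'))"

definition supp :: "(nat \<Rightarrow> nat) \<Rightarrow> nat" where
  "supp g = card {x. g x \<noteq> x}"

(* minimal degree, with m({e}) = infinity *)
definition min_degree :: "(nat \<Rightarrow> nat) set \<Rightarrow> enat" where
  "min_degree H = (INF h\<in>H - {id}. enat (supp h))"

end

theory Submission
  imports
    Defs
    "HOL-Algebra.Multiplicative_Group"
    "HOL-Analysis.L2_Norm"
    "Jordan_Normal_Form.Schur_Decomposition"
    "Jordan_Normal_Form.Spectral_Radius"
begin

text \<open>
  Everything rests on column orthogonality, \<open>\<Sum>\<chi>. \<chi> g * cnj (\<chi> h) = |{x. g x = x h}|\<close>.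
  By Cauchy--Schwarz it gives \<open>D\<^sub>H \<le> \<Sum>h\<noteq>e. sqrt (|C(h)| / |G|)\<close>; and since
  \<open>|\<Sum>h\<noteq>e. \<chi> h| \<le> |H| d\<^sub>\<chi>\<close>, it also gives \<open>D\<^sub>H \<ge> |C(h)| / (|G| |H|)\<close> for each \<open>h \<noteq> e\<close> in \<open>H\<close>.
  In \<open>S\<^sub>n\<close> an element of support \<open>s\<close> has at most \<open>n\<^sup>s\<close> conjugates, and at least about
  \<open>(n/2)\<^sup>k\<close> of them if \<open>s \<ge> 3k\<close> and \<open>n\<close> is large. Since \<open>|H| \<le> n\<^sup>c\<close> and \<open>ln n!\<close> lies between
  \<open>n\<close> and \<open>n\<^sup>2\<close>, both bounds are decided by whether the minimal degree is bounded.
\<close>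

section \<open>Traces and eigenvalues of complex matrices\<close>

text \<open>The main obstacle is completeness. Schur's lemma gives orthogonality of the rows of the
  character table, hence only inequalities of Bessel type. Centralizer orders appear as column sums,
  and these require that a class function orthogonal to all of \<open>Irr G\<close> vanishes. This
  is read off from a single irreducible constituent inside an eigenspace of an operator on the
  regular representation. To reach it with concrete matrices, a subspace is the image of a matrix
  with a left inverse, and facts about traces come from lists of eigenvalues.

  On the asymptotic side only exponents of \<open>n\<close> matter. Support at least
  \<open>3 * k\<close> makes |C(h)| / n! at most (n div 2)^(-k), hence at most n^(-k/2); the square
  root leaves n^(-k/4), and summing over \<open>H\<close> costs n^c. Since (ln n!)^(-c') is at least
  n^(-2c'), any fixed \<open>k\<close> above 4(c + 2c') contradicts distinguishability. Conversely,
  an element of support at most \<open>K\<close> gives exponent -(K + c), so \<open>K + c\<close>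
  serves as the constant of distinguishability.\<close>

lemma mat_trace_mult:
  assumes "A \<in> carrier_mat n m" "B \<in> carrier_mat m n"
  shows "mat_trace (A * B) = (\<Sum>i<n. \<Sum>j<m. A $$ (i,j) * B $$ (j,i))"
  using assms by (auto simp: mat_trace_def scalar_prod_def atLeast0LessThan intro!: sum.cong)

lemma mat_trace_comm:
  assumes "A \<in> carrier_mat n m" "B \<in> carrier_mat m n"
  shows "mat_trace (A * B) = mat_trace (B * A)"
  unfolding mat_trace_mult[OF assms] mat_trace_mult[OF assms(2,1)]
  by (subst sum.swap) (simp add: mult.commute)

lemma mat_trace_one [simp]: "mat_trace (1\<^sub>m n) = of_nat n"
  by (simp add: mat_trace_def)

text \<open>In the entry (i,j) with \<open>j \<le> i\<close>, a summand \<open>l\<close> vanishes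
  through the power when \<open>l < i\<close> and through \<open>B\<close> when
  \<open>j < l\<close>. The only exception is \<open>l = i = j\<close>.\<close>

lemma upper_triangular_pow:
  fixes B :: "complex mat"
  assumes "B \<in> carrier_mat n n" "upper_triangular B"
  shows "upper_triangular (B ^\<^sub>m k) \<and> (\<forall>i<n. (B ^\<^sub>m k) $$ (i,i) = (B $$ (i,i)) ^ k)"
proof (induction k)
  case 0
  then show ?case using assms by simp
next
  case (Suc k)
  let ?P = "B ^\<^sub>m k"
  have P: "?P \<in> carrier_mat n n" using assms by simp
  have e: "(?P * B) $$ (i,j) = (\<Sum>l<n. ?P $$ (i,l) * B $$ (l,j))" if "i < n" "j < n" for i j
    using that P assms by (simp add: scalar_prod_def atLeast0LessThan)
  have z: "?P $$ (i,l) * B $$ (l,j) = 0" if "i < n" "l < n" "j < i \<or> j = i \<and> l \<noteq> i" for i j l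
  proof (cases "l < i")
    case True
    then show ?thesis using upper_triangularD[of ?P l i] Suc that P by auto
  next
    case False
    then have "j < l" using that by auto
    then show ?thesis using upper_triangularD[of B j l] assms that by auto
  qed
  have "(?P * B) $$ (i,j) = 0" if "j < i" "i < n" for i j
    using e[of i j] that z by (simp add: sum.neutral)
  moreover have "(?P * B) $$ (i,i) = (B $$ (i,i)) ^ Suc k" if "i < n" for i
  proof -
    have "(\<Sum>l<n. ?P $$ (i,l) * B $$ (l,i)) = (\<Sum>l\<in>{i}. ?P $$ (i,l) * B $$ (l,i))"
      by (rule sum.mono_neutral_right) (use that z in auto)
    then show ?thesis using e[of i i] that Suc by simp
  qed
  ultimately show ?case using P assms by (auto intro!: upper_triangularI)
qed

text \<open>Schur triangulation makes all powers of \<open>A\<close> triangular at once, so one list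
  \<open>es\<close> serves every exponent. An algebraic equation for \<open>A\<close> thereby
  becomes an equation for each summand of the trace.\<close>

lemma mat_trace_pow_eigenvalues:
  fixes A :: "complex mat"
  assumes A: "A \<in> carrier_mat n n"
  obtains es where "length es = n" "\<And>k. mat_trace (A ^\<^sub>m k) = (\<Sum>e\<leftarrow>es. e ^ k)"
    "\<And>e. e \<in> set es \<Longrightarrow> eigenvalue A e"
proof -
  from char_poly_factorized[OF A] obtain es where
    es: "char_poly A = (\<Prod>a\<leftarrow>es. [:- a, 1:])" "length es = n" by blast
  obtain B P Q where s: "schur_decomposition A es = (B, P, Q)" by (metis prod_cases3)
  from schur_decomposition[OF A es(1) s]
  have w: "similar_mat_wit A B P Q" and u: "upper_triangular B" and d: "diag_mat B = es" by auto
  have B: "B \<in> carrier_mat n n" and P: "P \<in> carrier_mat n n" and Q: "Q \<in> carrier_mat n n"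
    and QP: "Q * P = 1\<^sub>m n"
    using similar_mat_witD2[OF A w] by auto
  have "mat_trace (A ^\<^sub>m k) = (\<Sum>e\<leftarrow>es. e ^ k)" for k
  proof -
    let ?C = "B ^\<^sub>m k"
    have C: "?C \<in> carrier_mat n n" using B by simp
    have "A ^\<^sub>m k = P * ?C * Q"
      using similar_mat_wit_pow[OF w, of k] by (simp add: similar_mat_wit_def Let_def)
    then have "mat_trace (A ^\<^sub>m k) = mat_trace (P * (?C * Q))"
      using assoc_mult_mat[OF P C Q] by simp
    also have "\<dots> = mat_trace (?C * Q * P)"
      by (rule mat_trace_comm[OF P]) (use C Q in auto)
    also have "?C * Q * P = ?C" using assoc_mult_mat[OF C Q P] QP right_mult_one_mat[OF C] by simp
    also have "mat_trace ?C = (\<Sum>i<n. (B $$ (i,i)) ^ k)"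
      using upper_triangular_pow[OF B u] C by (auto simp: mat_trace_def)
    also have "\<dots> = (\<Sum>e\<leftarrow>es. e ^ k)"
      using B by (auto simp: d[symmetric] diag_mat_def sum_list_sum_nth atLeast0LessThan)
    finally show ?thesis .
  qed
  moreover have "eigenvalue A e" if "e \<in> set es" for e
  proof -
    have "poly (char_poly A) e = 0" unfolding es(1) by (rule linear_poly_root[OF that])
    then show ?thesis using eigenvalue_root_char_poly[OF A] by simp
  qed
  ultimately show ?thesis using that es(2) by blast
qed

lemma eigenvalue_pow:
  fixes A :: "complex mat"
  assumes A: "A \<in> carrier_mat n n" and e: "eigenvalue A e"
  obtains v where "v \<in> carrier_vec n" "v \<noteq> 0\<^sub>v n" "\<And>k. A ^\<^sub>m k *\<^sub>v v = e ^ k \<cdot>\<^sub>v v"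
proof -
  from e obtain v where "eigenvector A v e" unfolding eigenvalue_def by blast
  then show ?thesis using that[of v] eigenvector_pow[OF A, of v e] A by (auto simp: eigenvector_def)
qed

lemma smult_vec_eq_cancel:
  fixes v :: "complex vec"
  assumes "v \<in> carrier_vec n" "v \<noteq> 0\<^sub>v n" "a \<cdot>\<^sub>v v = b \<cdot>\<^sub>v v"
  shows "a = b"
proof -
  obtain i where i: "i < n" "v $ i \<noteq> 0" using assms(1,2) by (metis carrier_vecD eq_vecI index_zero_vec)
  then show ?thesis using arg_cong[OF assms(3), of "\<lambda>w. w $ i"] assms(1) by simp
qed

text \<open>The eigenvalues are \<open>k\<close>-th roots of unity, so their inverses are their
  conjugates, and \<open>A ^\<^sub>m (k - 1)\<close> is the inverse of \<open>A\<close>. For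
  characters this does the work of a unitary form of the representation.\<close>

lemma mat_trace_finite_order:
  fixes A :: "complex mat"
  assumes A: "A \<in> carrier_mat n n" and k: "k > 0" "A ^\<^sub>m k = 1\<^sub>m n"
  shows "cmod (mat_trace A) \<le> real n" "mat_trace (A ^\<^sub>m (k - 1)) = cnj (mat_trace A)"
proof -
  obtain es where es: "length es = n" "\<And>k. mat_trace (A ^\<^sub>m k) = (\<Sum>e\<leftarrow>es. e ^ k)"
    "\<And>e. e \<in> set es \<Longrightarrow> eigenvalue A e"
    using mat_trace_pow_eigenvalues[OF A] by blast
  have one: "e ^ k = 1" if e: "e \<in> set es" for e
  proof -
    obtain v where v: "v \<in> carrier_vec n" "v \<noteq> 0\<^sub>v n" "\<And>k. A ^\<^sub>m k *\<^sub>v v = e ^ k \<cdot>\<^sub>v v"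
      using eigenvalue_pow[OF A es(3)[OF e]] by blast
    then have "e ^ k \<cdot>\<^sub>v v = 1 \<cdot>\<^sub>v v" using v(3)[of k] k by simp
    then show ?thesis using smult_vec_eq_cancel v by blast
  qed
  have mod: "cmod e = 1" if "e \<in> set es" for e
    using one[OF that] k(1) by (metis norm_ge_zero norm_one norm_power power_eq_1_iff abs_of_nonneg not_gr0 norm_power real_norm_def)
  have "cmod (\<Sum>e\<leftarrow>es. e) \<le> (\<Sum>e\<leftarrow>es. cmod e)"
    by (induction es) (auto intro: norm_triangle_le)
  also have "(\<Sum>e\<leftarrow>es. cmod e) = (\<Sum>e\<leftarrow>es. 1)"
    using mod by (intro arg_cong[of _ _ sum_list] map_cong) auto
  finally show "cmod (mat_trace A) \<le> real n" using es(1) es(2)[of 1] A by (simp add: sum_list_triv)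
  have inv: "e ^ (k - 1) = cnj e" if "e \<in> set es" for e
  proof -
    have "e * e ^ (k - 1) = 1" using one[OF that] k(1) by (metis power_minus_mult mult.commute)
    moreover have "e * cnj e = 1" using mod[OF that] complex_norm_square[of e] by simp
    ultimately show ?thesis by (metis mult_cancel_left zero_neq_one mult_zero_left)
  qed
  have "mat_trace (A ^\<^sub>m (k - 1)) = (\<Sum>e\<leftarrow>es. cnj e)"
    unfolding es(2) using inv by (intro arg_cong[of _ _ sum_list] map_cong) auto
  also have "\<dots> = cnj (\<Sum>e\<leftarrow>es. e)" by (induction es) auto
  finally show "mat_trace (A ^\<^sub>m (k - 1)) = cnj (mat_trace A)" using es(2)[of 1] A by simp
qed

section \<open>Bases of subspaces, encoded by matrices with a left inverse\<close>

text \<open>\<open>T * L\<close> is idempotent, so its eigenvalues are 0 or 1 and its trace is at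
  most \<open>d\<close>; that trace equals the trace of \<open>L * T\<close>, which is
  \<open>m\<close>.\<close>

lemma left_inverse_imp_dim_le:
  fixes T L :: "complex mat"
  assumes T: "T \<in> carrier_mat d m" and L: "L \<in> carrier_mat m d" and LT: "L * T = 1\<^sub>m m"
  shows "m \<le> d"
proof -
  let ?P = "T * L"
  have P: "?P \<in> carrier_mat d d" using T L by simp
  have "?P * ?P = T * (L * T * L)"
    using T L by (simp add: assoc_mult_mat[of _ d m _ d _ d] assoc_mult_mat[of _ m d _ m _ d])
  then have PP: "?P ^\<^sub>m 2 = ?P" using LT L P by (simp add: numeral_2_eq_2)
  obtain es where es: "length es = d" "\<And>k. mat_trace (?P ^\<^sub>m k) = (\<Sum>e\<leftarrow>es. e ^ k)"
    "\<And>e. e \<in> set es \<Longrightarrow> eigenvalue ?P e"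
    using mat_trace_pow_eigenvalues[OF P] by blast
  have le: "Re e \<le> 1" if e: "e \<in> set es" for e
  proof -
    obtain v where v: "v \<in> carrier_vec d" "v \<noteq> 0\<^sub>v d" "\<And>k. ?P ^\<^sub>m k *\<^sub>v v = e ^ k \<cdot>\<^sub>v v"
      using eigenvalue_pow[OF P es(3)[OF e]] by blast
    have "e ^ 2 \<cdot>\<^sub>v v = e ^ 1 \<cdot>\<^sub>v v" using v(3)[of 1] v(3)[of 2] P unfolding PP by simp
    then have "e ^ 2 = e ^ 1" using smult_vec_eq_cancel v by blast
    then have "e = 0 \<or> e = 1" by (simp add: power2_eq_square)
    then show ?thesis by auto
  qed
  have "of_nat m = mat_trace ?P" using mat_trace_comm[OF T L] LT by simp
  also have "\<dots> = (\<Sum>e\<leftarrow>es. e)" using es(2)[of 1] P by simp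
  finally have "real m = Re (\<Sum>e\<leftarrow>es. e)" by (metis Re_complex_of_real of_real_of_nat_eq)
  also have "\<dots> = (\<Sum>e\<leftarrow>es. Re e)" by (induction es) auto
  also have "\<dots> \<le> (\<Sum>e\<leftarrow>es. 1)" using le by (intro sum_list_mono) auto
  finally show ?thesis using es(1) by (simp add: sum_list_triv)
qed

text \<open>The columns of \<open>T\<close> form a basis of \<open>W\<close>, with \<open>L\<close>
  certifying independence. A largest pair with image inside \<open>W\<close> exists because
  \<open>m \<le> d\<close>; a vector of \<open>W\<close> outside the image would allow one more
  column.\<close>

lemma subspace_basis_left_inverse:
  assumes W: "is_subspace d W"
  obtains m T L where "m \<le> d" "T \<in> carrier_mat d m" "L \<in> carrier_mat m d" "L * T = 1\<^sub>m m"
    "W = {T *\<^sub>v x | x. x \<in> carrier_vec m}"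
proof -
  define P where "P m \<longleftrightarrow> (\<exists>T\<in>carrier_mat d m. \<exists>L\<in>carrier_mat m d. L * T = 1\<^sub>m m \<and>
    (\<forall>x\<in>carrier_vec m. T *\<^sub>v x \<in> W))" for m
  have Wd: "W \<subseteq> carrier_vec d" "0\<^sub>v d \<in> W" and Wadd: "\<And>v w. v \<in> W \<Longrightarrow> w \<in> W \<Longrightarrow> v + w \<in> W"
    and Wsm: "\<And>a v. v \<in> W \<Longrightarrow> a \<cdot>\<^sub>v v \<in> W"
    using W by (auto simp: is_subspace_def)
  have "P 0" unfolding P_def
  proof (intro bexI conjI ballI)
    show "0\<^sub>m 0 d * 0\<^sub>m d 0 = 1\<^sub>m 0" by (intro eq_matI) auto
    show "0\<^sub>m d 0 *\<^sub>v x \<in> W" if "x \<in> carrier_vec 0" for x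
    proof -
      have "0\<^sub>m d 0 *\<^sub>v x = 0\<^sub>v d" using that by (intro eq_vecI) (auto simp: scalar_prod_def)
      then show ?thesis using Wd by simp
    qed
  qed auto
  moreover have bd: "\<forall>m. P m \<longrightarrow> m \<le> d"
    unfolding P_def using left_inverse_imp_dim_le by blast
  ultimately have "P (Greatest P)" and G: "\<And>m. P m \<Longrightarrow> m \<le> Greatest P"
    using GreatestI_nat[of P 0 d] Greatest_le_nat[of P _ d] by blast+
  define m where "m = Greatest P"
  obtain T L where T: "T \<in> carrier_mat d m" and L: "L \<in> carrier_mat m d" and LT: "L * T = 1\<^sub>m m"
    and TW: "\<And>x. x \<in> carrier_vec m \<Longrightarrow> T *\<^sub>v x \<in> W"
    using \<open>P (Greatest P)\<close> unfolding P_def m_def by blast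
  have "v \<in> {T *\<^sub>v x | x. x \<in> carrier_vec m}" if v: "v \<in> W" for v
  proof (rule ccontr)
    assume nv: "v \<notin> {T *\<^sub>v x | x. x \<in> carrier_vec m}"
    have vd: "v \<in> carrier_vec d" using v Wd by auto
    define y where "y = T *\<^sub>v (L *\<^sub>v v)"
    have y: "y \<in> carrier_vec d" "y \<in> W" using T L vd TW[of "L *\<^sub>v v"] by (auto simp: y_def)
    \<comment> \<open>Removing the component of \<open>v\<close> in the image of \<open>T\<close>
      leaves a nonzero vector that \<open>L\<close> annihilates, so the old rows of the left inverse
      can be kept.\<close>
    define u where "u = v + (-1) \<cdot>\<^sub>v y"
    have u: "u \<in> carrier_vec d" "u \<in> W" using y vd v Wadd Wsm by (auto simp: u_def)
    have "u \<noteq> 0\<^sub>v d"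
    proof
      assume "u = 0\<^sub>v d"
      then have "v $ i = y $ i" if "i < d" for i
      proof -
        have "u $ i = 0" using \<open>u = 0\<^sub>v d\<close> that by simp
        then show ?thesis using that vd y unfolding u_def by simp
      qed
      then have "v = y" using vd y by (intro eq_vecI) auto
      then show False using nv L vd unfolding y_def by (metis (mono_tags, lifting) mem_Collect_eq mult_mat_vec_carrier)
    qed
    then obtain i0 where i0: "i0 < d" "u $ i0 \<noteq> 0"
      using u(1) by (metis carrier_vecD eq_vecI index_zero_vec)
    have Lu: "L *\<^sub>v u = 0\<^sub>v m"
    proof -
      have "L *\<^sub>v y = L *\<^sub>v v" unfolding y_def
        using assoc_mult_mat_vec[OF L T, of "L *\<^sub>v v"] LT L vd by simp
      then have "L *\<^sub>v u = L *\<^sub>v v + (-1) \<cdot>\<^sub>v (L *\<^sub>v v)" unfolding u_def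
        using mult_add_distrib_mat_vec[OF L vd, of "(-1) \<cdot>\<^sub>v y"] y mult_mat_vec[OF L y(1), of "-1"] by simp
      then show ?thesis using L by (intro eq_vecI) auto
    qed
    define f where "f = 1 / u $ i0"
    \<comment> \<open>The new row of the left inverse is row \<open>i0\<close> of 1 - T L, scaled to
      take the value 1 at \<open>u\<close>. It annihilates the columns of \<open>T\<close> because
      \<open>L * T\<close> is the identity.\<close>
    define p where "p j = f * ((if j = i0 then 1 else 0) - (\<Sum>k<m. T $$ (i0,k) * L $$ (k,j)))" for j
    have Tx: "(T *\<^sub>v x) $ i = (\<Sum>k<m. T $$ (i,k) * x $ k)" if "i < d" "x \<in> carrier_vec m" for i x
      using that T by (simp add: scalar_prod_def atLeast0LessThan)
    have LTe: "(\<Sum>j<d. L $$ (k,j) * T $$ (j,l)) = (if k = l then 1 else 0)" if "k < m" "l < m" for k l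
      using arg_cong[OF LT, of "\<lambda>M. M $$ (k,l)"] that T L by (simp add: scalar_prod_def atLeast0LessThan)
    have Lue: "(\<Sum>j<d. L $$ (k,j) * u $ j) = 0" if "k < m" for k
      using arg_cong[OF Lu, of "\<lambda>M. M $ k"] that L u by (simp add: scalar_prod_def atLeast0LessThan)
    have pw: "(\<Sum>j<d. p j * w j) = f * (w i0 - (\<Sum>k<m. T $$ (i0,k) * (\<Sum>j<d. L $$ (k,j) * w j)))" for w
    proof -
      have "(\<Sum>j<d. p j * w j) = f * ((\<Sum>j<d. (if j = i0 then 1 else 0) * w j) -
          (\<Sum>j<d. (\<Sum>k<m. T $$ (i0,k) * L $$ (k,j)) * w j))"
        by (simp add: p_def algebra_simps sum_subtractf sum_distrib_left sum_distrib_right)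
      also have "(\<Sum>j<d. (if j = i0 then 1 else 0) * w j) = w i0"
        using i0 by (simp add: if_distrib[of "\<lambda>a. a * _"] cong: if_cong)
      also have "(\<Sum>j<d. (\<Sum>k<m. T $$ (i0,k) * L $$ (k,j)) * w j) =
          (\<Sum>k<m. T $$ (i0,k) * (\<Sum>j<d. L $$ (k,j) * w j))"
        by (simp add: sum_distrib_left sum_distrib_right mult.assoc) (rule sum.swap)
      finally show ?thesis .
    qed
    have pu: "(\<Sum>j<d. p j * u $ j) = 1" unfolding pw using Lue i0 by (simp add: f_def)
    have pT: "(\<Sum>j<d. p j * T $$ (j,l)) = 0" if "l < m" for l
      unfolding pw using LTe that by (simp add: if_distrib[of "\<lambda>a. _ * a"] cong: if_cong)
    define T' where "T' = mat d (Suc m) (\<lambda>(i,j). if j < m then T $$ (i,j) else u $ i)"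
    define L' where "L' = mat (Suc m) d (\<lambda>(i,j). if i < m then L $$ (i,j) else p j)"
    have "P (Suc m)" unfolding P_def
    proof (intro bexI conjI ballI)
      show "L' * T' = 1\<^sub>m (Suc m)"
      proof (intro eq_matI)
        fix i j assume ij: "i < dim_row (1\<^sub>m (Suc m) :: complex mat)" "j < dim_col (1\<^sub>m (Suc m) :: complex mat)"
        have "(L' * T') $$ (i,j) = (\<Sum>k<d. L' $$ (i,k) * T' $$ (k,j))"
          using ij by (simp add: L'_def T'_def scalar_prod_def atLeast0LessThan)
        also have "\<dots> = (\<Sum>k<d. (if i < m then L $$ (i,k) else p k) * (if j < m then T $$ (k,j) else u $ k))"
          using ij by (intro sum.cong) (auto simp: L'_def T'_def)
        also have "\<dots> = (if i = j then 1 else 0)"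
          using ij LTe Lue pu pT by (auto simp: less_Suc_eq)
        finally show "(L' * T') $$ (i,j) = 1\<^sub>m (Suc m) $$ (i,j)" using ij by simp
      qed (auto simp: L'_def T'_def)
      show "T' *\<^sub>v x \<in> W" if x: "x \<in> carrier_vec (Suc m)" for x
      proof -
        have "T' *\<^sub>v x = T *\<^sub>v vec m (\<lambda>i. x $ i) + (x $ m) \<cdot>\<^sub>v u"
        proof (intro eq_vecI)
          fix i assume "i < dim_vec (T *\<^sub>v vec m (\<lambda>i. x $ i) + (x $ m) \<cdot>\<^sub>v u)"
          then have i: "i < d" using u by simp
          have "(T' *\<^sub>v x) $ i = (\<Sum>k<Suc m. (if k < m then T $$ (i,k) else u $ i) * x $ k)"
            using i x by (auto simp: T'_def scalar_prod_def atLeast0LessThan)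
          also have "\<dots> = (\<Sum>k<m. T $$ (i,k) * x $ k) + x $ m * u $ i" by simp
          finally show "(T' *\<^sub>v x) $ i = (T *\<^sub>v vec m (\<lambda>i. x $ i) + (x $ m) \<cdot>\<^sub>v u) $ i"
            using i u Tx[OF i, of "vec m (\<lambda>i. x $ i)"] T by (simp add: less_eq_Suc_le)
        qed (use T u in \<open>auto simp: T'_def\<close>)
        then show ?thesis using Wadd Wsm TW u by simp
      qed
    qed (auto simp: L'_def T'_def)
    from G[OF this] show False by (simp add: m_def)
  qed
  with TW have "W = {T *\<^sub>v x | x. x \<in> carrier_vec m}" by blast
  moreover have "m \<le> d" using bd \<open>P (Greatest P)\<close> by (simp add: m_def)
  ultimately show ?thesis using that T L LT by blast
qed

lemma mat_eq_mult_vecI: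
  fixes A B :: "complex mat"
  assumes "A \<in> carrier_mat n m" "B \<in> carrier_mat n m"
    and "\<And>x. x \<in> carrier_vec m \<Longrightarrow> A *\<^sub>v x = B *\<^sub>v x"
  shows "A = B"
proof (intro eq_matI)
  fix i j assume ij: "i < dim_row B" "j < dim_col B"
  have "M $$ (i,j) = (M *\<^sub>v unit_vec m j) $ i" if "M \<in> carrier_mat n m" for M :: "complex mat"
    using that ij assms by (simp add: scalar_prod_right_unit)
  then show "A $$ (i,j) = B $$ (i,j)" using assms by simp
qed (use assms in auto)

section \<open>Subrepresentations and Schur's lemma\<close>

lemma is_repD:
  assumes "is_rep G d \<rho>"
  shows "d > 0" "\<And>g. g \<in> carrier G \<Longrightarrow> \<rho> g \<in> carrier_mat d d"
    "\<And>g h. g \<in> carrier G \<Longrightarrow> h \<in> carrier G \<Longrightarrow> \<rho> (mult G g h) = \<rho> g * \<rho> h"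
    "\<rho> (one G) = 1\<^sub>m d"
  using assms by (auto simp: is_rep_def)

lemma is_irrepD:
  assumes "is_irrep G d \<rho>"
  shows "is_rep G d \<rho>"
    "\<And>W. is_subspace d W \<Longrightarrow> (\<And>g v. g \<in> carrier G \<Longrightarrow> v \<in> W \<Longrightarrow> \<rho> g *\<^sub>v v \<in> W)
      \<Longrightarrow> W = {0\<^sub>v d} \<or> W = carrier_vec d"
  using assms by (auto simp: is_irrep_def)

text \<open>An injective intertwiner from \<open>\<sigma>\<close> into \<open>\<rho>\<close>.
  Injectivity is expressed by a left inverse, which itself may fail to commute with the
  group.\<close>

definition rep_embedding where
  "rep_embedding G d \<rho> m \<sigma> T \<longleftrightarrow> T \<in> carrier_mat d m \<and> (\<exists>L\<in>carrier_mat m d. L * T = 1\<^sub>m m) \<and>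
     (\<forall>g\<in>carrier G. \<rho> g * T = T * (\<sigma> g :: complex mat))"

lemma rep_embedding_compose:
  assumes r: "is_rep G d \<rho>" and s: "is_rep G m \<sigma>" and t: "is_rep G k \<tau>"
    and T: "rep_embedding G d \<rho> m \<sigma> T" and U: "rep_embedding G m \<sigma> k \<tau> U"
  shows "rep_embedding G d \<rho> k \<tau> (T * U)"
proof -
  obtain L K where T: "T \<in> carrier_mat d m" "L \<in> carrier_mat m d" "L * T = 1\<^sub>m m"
    "\<And>g. g \<in> carrier G \<Longrightarrow> \<rho> g * T = T * \<sigma> g"
    and U: "U \<in> carrier_mat m k" "K \<in> carrier_mat k m" "K * U = 1\<^sub>m k"
    "\<And>g. g \<in> carrier G \<Longrightarrow> \<sigma> g * U = U * \<tau> g"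
    using T U by (auto simp: rep_embedding_def)
  have "(K * L) * (T * U) = K * (L * T * U)"
    using assoc_mult_mat[OF U(2) T(2), of "T * U" k] assoc_mult_mat[OF T(2,1) U(1)] T U by simp
  then have "(K * L) * (T * U) = 1\<^sub>m k" using T U by simp
  moreover have "\<rho> g * (T * U) = (T * U) * \<tau> g" if g: "g \<in> carrier G" for g
  proof -
    have c: "\<rho> g \<in> carrier_mat d d" "\<sigma> g \<in> carrier_mat m m" "\<tau> g \<in> carrier_mat k k"
      using is_repD(2)[OF r g] is_repD(2)[OF s g] is_repD(2)[OF t g] by auto
    have "\<rho> g * (T * U) = T * \<sigma> g * U" using assoc_mult_mat[OF c(1) T(1) U(1)] T(4)[OF g] by simp
    also have "\<dots> = T * (U * \<tau> g)" using assoc_mult_mat[OF T(1) c(2) U(1)] U(4)[OF g] by simp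
    also have "\<dots> = (T * U) * \<tau> g" using assoc_mult_mat[OF T(1) U(1) c(3)] by simp
    finally show ?thesis .
  qed
  moreover have "T * U \<in> carrier_mat d k" "K * L \<in> carrier_mat k d" using T U by auto
  ultimately show ?thesis by (auto simp: rep_embedding_def)
qed

text \<open>In the basis given by the columns of \<open>T\<close>, the action on \<open>W\<close> is
  \<open>L * (\<rho> g * T)\<close>: invariance puts \<open>\<rho> g\<close> applied to
  \<open>T *\<^sub>v x\<close> in the image of \<open>T\<close>, and \<open>L\<close> recovers its
  coordinates. The clause for \<open>m = d\<close> makes the induction in
  \<open>contains_irrep\<close> descend.\<close>

lemma (in group) subrep:
  assumes rep: "is_rep G d \<rho>" and W: "is_subspace d W" "W \<noteq> {0\<^sub>v d}"
    and inv: "\<And>g v. g \<in> carrier G \<Longrightarrow> v \<in> W \<Longrightarrow> \<rho> g *\<^sub>v v \<in> W"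
  shows "\<exists>m \<sigma> T. is_rep G m \<sigma> \<and> m \<le> d \<and> (m = d \<longrightarrow> W = carrier_vec d) \<and>
    rep_embedding G d \<rho> m \<sigma> T \<and> (\<forall>x\<in>carrier_vec m. T *\<^sub>v x \<in> W)"
proof -
  obtain m T L where m: "m \<le> d" and T: "T \<in> carrier_mat d m" and L: "L \<in> carrier_mat m d"
    and LT: "L * T = 1\<^sub>m m" and We: "W = {T *\<^sub>v x | x. x \<in> carrier_vec m}"
    using subspace_basis_left_inverse[OF W(1)] by blast
  note rD = is_repD[OF rep]
  define \<sigma> where "\<sigma> g = L * (\<rho> g * T)" for g
  have \<sigma>c: "\<sigma> g \<in> carrier_mat m m" if "g \<in> carrier G" for g
    using rD(2)[OF that] L T by (simp add: \<sigma>_def)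
  have tw: "\<rho> g * T = T * \<sigma> g" if g: "g \<in> carrier G" for g
  proof (rule mat_eq_mult_vecI)
    note r = rD(2)[OF g]
    show "\<rho> g * T \<in> carrier_mat d m" "T * \<sigma> g \<in> carrier_mat d m" using r T \<sigma>c[OF g] by auto
    fix x :: "complex vec" assume x: "x \<in> carrier_vec m"
    have "\<rho> g *\<^sub>v (T *\<^sub>v x) \<in> W" using inv[OF g] x We by blast
    then obtain y where y: "y \<in> carrier_vec m" "\<rho> g *\<^sub>v (T *\<^sub>v x) = T *\<^sub>v y" using We by blast
    have "\<sigma> g *\<^sub>v x = L *\<^sub>v (\<rho> g *\<^sub>v (T *\<^sub>v x))" unfolding \<sigma>_def
      using r T L x by (simp add: assoc_mult_mat_vec[of _ m d _ m] assoc_mult_mat_vec[of _ d d _ m])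
    also have "\<dots> = (L * T) *\<^sub>v y" unfolding y(2) using assoc_mult_mat_vec[OF L T y(1)] by simp
    also have "\<dots> = y" using LT y by simp
    finally have sx: "\<sigma> g *\<^sub>v x = y" .
    show "(\<rho> g * T) *\<^sub>v x = (T * \<sigma> g) *\<^sub>v x"
      using assoc_mult_mat_vec[OF r T x] assoc_mult_mat_vec[OF T \<sigma>c[OF g] x] y sx by simp
  qed
  \<comment> \<open>A representation has positive dimension by definition, so the zero subspace has
    to be excluded.\<close>
  have "m \<noteq> 0"
  proof
    assume "m = 0"
    then have "T *\<^sub>v x = 0\<^sub>v d" if "x \<in> carrier_vec m" for x
      using that T by (intro eq_vecI) (auto simp: scalar_prod_def)
    then have "W \<subseteq> {0\<^sub>v d}" using We by auto
    then show False using W by (auto simp: is_subspace_def)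
  qed
  moreover have "\<sigma> (g \<otimes> h) = \<sigma> g * \<sigma> h" if g: "g \<in> carrier G" and h: "h \<in> carrier G" for g h
  proof -
    have r: "\<rho> g \<in> carrier_mat d d" "\<rho> h \<in> carrier_mat d d" using rD(2) g h by auto
    have "\<sigma> (g \<otimes> h) = L * (\<rho> g * (\<rho> h * T))"
      unfolding \<sigma>_def using rD(3)[OF g h] assoc_mult_mat[OF r T] by simp
    also have "\<dots> = L * (\<rho> g * T * \<sigma> h)"
      unfolding tw[OF h] using assoc_mult_mat[OF r(1) T \<sigma>c[OF h]] by simp
    also have "\<dots> = \<sigma> g * \<sigma> h"
      unfolding \<sigma>_def[of g] using assoc_mult_mat[OF L _ \<sigma>c[OF h], of "\<rho> g * T"] r T by simp
    finally show ?thesis .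
  qed
  moreover have "\<sigma> \<one> = 1\<^sub>m m" using rD(4) T LT by (simp add: \<sigma>_def)
  ultimately have "is_rep G m \<sigma>" using \<sigma>c by (auto simp: is_rep_def)
  moreover have "W = carrier_vec d" if "m = d"
  proof -
    have TL: "T * L = 1\<^sub>m d" using mat_mult_left_right_inverse[of L d T] L T LT that by simp
    have "v \<in> W" if v: "v \<in> carrier_vec d" for v
    proof -
      have "T *\<^sub>v (L *\<^sub>v v) = v" using assoc_mult_mat_vec[OF T L v] TL v by simp
      moreover have "L *\<^sub>v v \<in> carrier_vec m" using L v by simp
      ultimately show ?thesis unfolding We by (metis (mono_tags, lifting) mem_Collect_eq)
    qed
    then show ?thesis using W by (auto simp: is_subspace_def)
  qed
  moreover have "rep_embedding G d \<rho> m \<sigma> T" using T L LT tw by (auto simp: rep_embedding_def)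
  ultimately show ?thesis using m We by (intro exI[of _ m] exI[of _ \<sigma>] exI[of _ T]) blast
qed

text \<open>Strong induction on the dimension: a reducible representation has a proper nonzero
  invariant subspace, and embeddings compose.\<close>

lemma (in group) contains_irrep:
  assumes "is_rep G d \<rho>"
  shows "\<exists>m \<sigma> T. is_irrep G m \<sigma> \<and> rep_embedding G d \<rho> m \<sigma> T"
  using assms
proof (induction d arbitrary: \<rho> rule: less_induct)
  case (less d)
  show ?case
  proof (cases "is_irrep G d \<rho>")
    case True
    moreover have "rep_embedding G d \<rho> d \<rho> (1\<^sub>m d)"
      using left_mult_one_mat[OF is_repD(2)[OF less.prems]] right_mult_one_mat[OF is_repD(2)[OF less.prems]]
      by (auto simp: rep_embedding_def intro!: bexI[of _ "1\<^sub>m d"])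
    ultimately show ?thesis by blast
  next
    case False
    then obtain W where W: "is_subspace d W" "W \<noteq> {0\<^sub>v d}" "W \<noteq> carrier_vec d"
      and inv: "\<And>g v. g \<in> carrier G \<Longrightarrow> v \<in> W \<Longrightarrow> \<rho> g *\<^sub>v v \<in> W"
      using less.prems by (auto simp: is_irrep_def)
    from subrep[OF less.prems W(1,2) inv] obtain m \<sigma> T where
      m: "m \<le> d" "m = d \<longrightarrow> W = carrier_vec d" and s: "is_rep G m \<sigma>" and T: "rep_embedding G d \<rho> m \<sigma> T"
      by blast
    have "m < d" using m W(3) by linarith
    from less.IH[OF this s] obtain k \<tau> U where "is_irrep G k \<tau>" "rep_embedding G m \<sigma> k \<tau> U" by blast
    then show ?thesis using rep_embedding_compose[OF less.prems s _ T] is_irrepD(1) by blast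
  qed
qed

text \<open>To be applied to an eigenspace \<open>W\<close> of an operator commuting with the group.
  That the image lies in \<open>W\<close> is what hands the eigenvalue down to the irreducible
  piece.\<close>

lemma (in group) irrep_in_invariant_subspace:
  assumes rep: "is_rep G d \<rho>" and W: "is_subspace d W" "W \<noteq> {0\<^sub>v d}"
    and inv: "\<And>g v. g \<in> carrier G \<Longrightarrow> v \<in> W \<Longrightarrow> \<rho> g *\<^sub>v v \<in> W"
  shows "\<exists>m \<sigma> T. is_irrep G m \<sigma> \<and> rep_embedding G d \<rho> m \<sigma> T \<and> (\<forall>x\<in>carrier_vec m. T *\<^sub>v x \<in> W)"
proof -
  from subrep[OF rep W inv] obtain m \<sigma> T where
    s: "is_rep G m \<sigma>" and T: "rep_embedding G d \<rho> m \<sigma> T" and TW: "\<And>x. x \<in> carrier_vec m \<Longrightarrow> T *\<^sub>v x \<in> W"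
    by blast
  obtain k \<tau> U where t: "is_irrep G k \<tau>" and U: "rep_embedding G m \<sigma> k \<tau> U"
    using contains_irrep[OF s] by blast
  have "(T * U) *\<^sub>v x \<in> W" if "x \<in> carrier_vec k" for x
    using assoc_mult_mat_vec[OF _ _ that, of T d m U] TW[of "U *\<^sub>v x"] T U that
    by (auto simp: rep_embedding_def)
  then show ?thesis using t rep_embedding_compose[OF rep s is_irrepD(1)[OF t] T U] by blast
qed

section \<open>Finite sums of matrices and Schur's lemma\<close>

text \<open>Matrices of all sizes share one type, so the size of a sum, in particular of an empty
  one, has to be given explicitly.\<close>

definition mat_sum :: "nat \<Rightarrow> nat \<Rightarrow> 'a set \<Rightarrow> ('a \<Rightarrow> complex mat) \<Rightarrow> complex mat" where
  "mat_sum n m S F = mat n m (\<lambda>(i,j). \<Sum>s\<in>S. F s $$ (i,j))"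

lemma mat_sum_carrier [simp]: "mat_sum n m S F \<in> carrier_mat n m"
  by (simp add: mat_sum_def)

lemma index_mat_sum: "i < n \<Longrightarrow> j < m \<Longrightarrow> mat_sum n m S F $$ (i,j) = (\<Sum>s\<in>S. F s $$ (i,j))"
  by (simp add: mat_sum_def)

lemma mat_sum_mult_left:
  assumes "A \<in> carrier_mat l n" "\<And>s. s \<in> S \<Longrightarrow> F s \<in> carrier_mat n m"
  shows "A * mat_sum n m S F = mat_sum l m S (\<lambda>s. A * F s)"
proof (intro eq_matI)
  fix i j assume ij: "i < dim_row (mat_sum l m S (\<lambda>s. A * F s))" "j < dim_col (mat_sum l m S (\<lambda>s. A * F s))"
  then have ij: "i < l" "j < m" by (auto simp: mat_sum_def)
  have "(A * mat_sum n m S F) $$ (i,j) = (\<Sum>k<n. A $$ (i,k) * (\<Sum>s\<in>S. F s $$ (k,j)))"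
    using assms(1) ij by (simp add: mat_sum_def scalar_prod_def atLeast0LessThan)
  also have "\<dots> = (\<Sum>s\<in>S. \<Sum>k<n. A $$ (i,k) * F s $$ (k,j))"
    unfolding sum_distrib_left by (rule sum.swap)
  also have "\<dots> = (\<Sum>s\<in>S. (A * F s) $$ (i,j))"
    by (intro sum.cong refl) (use assms ij in \<open>auto dest!: assms(2) simp: scalar_prod_def atLeast0LessThan\<close>)
  finally show "(A * mat_sum n m S F) $$ (i,j) = mat_sum l m S (\<lambda>s. A * F s) $$ (i,j)"
    using ij by (simp add: mat_sum_def)
qed (use assms in \<open>auto simp: mat_sum_def\<close>)

lemma mat_sum_mult_right:
  assumes "A \<in> carrier_mat m l" "\<And>s. s \<in> S \<Longrightarrow> F s \<in> carrier_mat n m"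
  shows "mat_sum n m S F * A = mat_sum n l S (\<lambda>s. F s * A)"
proof (intro eq_matI)
  fix i j assume ij: "i < dim_row (mat_sum n l S (\<lambda>s. F s * A))" "j < dim_col (mat_sum n l S (\<lambda>s. F s * A))"
  then have ij: "i < n" "j < l" by (auto simp: mat_sum_def)
  have "(mat_sum n m S F * A) $$ (i,j) = (\<Sum>k<m. (\<Sum>s\<in>S. F s $$ (i,k)) * A $$ (k,j))"
    using assms(1) ij by (simp add: mat_sum_def scalar_prod_def atLeast0LessThan)
  also have "\<dots> = (\<Sum>s\<in>S. \<Sum>k<m. F s $$ (i,k) * A $$ (k,j))"
    unfolding sum_distrib_right by (rule sum.swap)
  also have "\<dots> = (\<Sum>s\<in>S. (F s * A) $$ (i,j))"
    by (intro sum.cong refl) (use assms ij in \<open>auto dest!: assms(2) simp: scalar_prod_def atLeast0LessThan\<close>)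
  finally show "(mat_sum n m S F * A) $$ (i,j) = mat_sum n l S (\<lambda>s. F s * A) $$ (i,j)"
    using ij by (simp add: mat_sum_def)
qed (use assms in \<open>auto simp: mat_sum_def\<close>)

lemma mat_sum_reindex:
  assumes "bij_betw h S S'" "\<And>s. s \<in> S \<Longrightarrow> F (h s) = F' s"
  shows "mat_sum n m S' F = mat_sum n m S F'"
proof -
  have "(\<Sum>s\<in>S'. F s $$ (i,j)) = (\<Sum>s\<in>S. F' s $$ (i,j))" for i j
    using sum.reindex_bij_betw[OF assms(1), of "\<lambda>s. F s $$ (i,j)"] assms(2) by simp
  then show ?thesis by (simp add: mat_sum_def)
qed

lemma mat_sum_cong: "(\<And>s. s \<in> S \<Longrightarrow> F s = F' s) \<Longrightarrow> mat_sum n m S F = mat_sum n m S F'"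
  by (simp add: mat_sum_def)

lemma mat_trace_sum:
  assumes "\<And>s. s \<in> S \<Longrightarrow> F s \<in> carrier_mat n n"
  shows "mat_trace (mat_sum n n S F) = (\<Sum>s\<in>S. mat_trace (F s))"
proof -
  have "(\<Sum>s\<in>S. mat_trace (F s)) = (\<Sum>s\<in>S. \<Sum>i<n. F s $$ (i,i))"
    unfolding mat_trace_def by (intro sum.cong refl) (auto dest!: assms)
  then show ?thesis unfolding mat_trace_def by (subst (asm) sum.swap) (simp add: mat_sum_def)
qed

lemma mat_trace_smult: "A \<in> carrier_mat n n \<Longrightarrow> mat_trace (a \<cdot>\<^sub>m A) = a * mat_trace A"
  by (auto simp: mat_trace_def sum_distrib_left)

lemma mult_mat_vec_zero:
  fixes A :: "complex mat"
  shows "A \<in> carrier_mat n m \<Longrightarrow> A *\<^sub>v 0\<^sub>v m = 0\<^sub>v n"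
  by (intro eq_vecI) auto

lemma is_subspace_kernel:
  assumes "T \<in> carrier_mat n m"
  shows "is_subspace m {v \<in> carrier_vec m. T *\<^sub>v v = 0\<^sub>v n}"
  unfolding is_subspace_def using assms
  by (auto simp: mult_add_distrib_mat_vec[of _ n m] mult_mat_vec[of _ n m])

lemma is_subspace_image:
  assumes T: "T \<in> carrier_mat n m"
  shows "is_subspace n {T *\<^sub>v x | x. x \<in> carrier_vec m}" (is "is_subspace n ?W")
  unfolding is_subspace_def
proof (intro conjI ballI allI)
  show "?W \<subseteq> carrier_vec n" using T by auto
  show "0\<^sub>v n \<in> ?W" using T by (intro CollectI exI[of _ "0\<^sub>v m"]) auto
next
  fix v w assume "v \<in> ?W" "w \<in> ?W"
  then obtain x y where "x \<in> carrier_vec m" "y \<in> carrier_vec m" "v = T *\<^sub>v x" "w = T *\<^sub>v y" by blast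
  then show "v + w \<in> ?W"
    using mult_add_distrib_mat_vec[OF T, of x y] by (intro CollectI exI[of _ "x + y"]) simp
next
  fix a v assume "v \<in> ?W"
  then obtain x where "x \<in> carrier_vec m" "v = T *\<^sub>v x" by blast
  then show "a \<cdot>\<^sub>v v \<in> ?W"
    using mult_mat_vec[OF T, of x a] by (intro CollectI exI[of _ "a \<cdot>\<^sub>v x"]) simp
qed

text \<open>Kernel and image of \<open>T\<close> are invariant, so irreducibility and
  \<open>T \<noteq> 0\<close> make the kernel zero and the image everything. Then \<open>T\<close>
  is invertible and conjugates \<open>\<sigma>\<close> into \<open>\<rho>\<close>. The
  contrapositive is used: if the characters differ, every intertwiner is zero.\<close>

lemma schur_distinct:
  assumes r: "is_irrep G d \<rho>" and s: "is_irrep G e \<sigma>" and T: "T \<in> carrier_mat d e"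
    and tw: "\<And>g. g \<in> carrier G \<Longrightarrow> \<rho> g * T = T * \<sigma> g" and nz: "T \<noteq> 0\<^sub>m d e"
  shows "\<And>g. g \<in> carrier G \<Longrightarrow> mat_trace (\<rho> g) = mat_trace (\<sigma> g)"
proof -
  have rc: "\<rho> g \<in> carrier_mat d d" and sc: "\<sigma> g \<in> carrier_mat e e" if "g \<in> carrier G" for g
    using is_repD(2)[OF is_irrepD(1)[OF r]] is_repD(2)[OF is_irrepD(1)[OF s]] that by auto
  have twv: "\<rho> g *\<^sub>v (T *\<^sub>v v) = T *\<^sub>v (\<sigma> g *\<^sub>v v)" if "g \<in> carrier G" "v \<in> carrier_vec e" for g v
    using tw[OF that(1)] assoc_mult_mat_vec[OF rc[OF that(1)] T that(2)] assoc_mult_mat_vec[OF T sc[OF that(1)] that(2)]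
    by simp
  have "\<exists>v\<in>carrier_vec e. T *\<^sub>v v \<noteq> 0\<^sub>v d"
  proof (rule ccontr)
    assume "\<not> ?thesis"
    then have "T = 0\<^sub>m d e" using T by (intro mat_eq_mult_vecI[of _ d e]) auto
    then show False using nz by simp
  qed
  then obtain v0 where v0: "v0 \<in> carrier_vec e" "T *\<^sub>v v0 \<noteq> 0\<^sub>v d" by blast
  let ?K = "{v \<in> carrier_vec e. T *\<^sub>v v = 0\<^sub>v d}"
  let ?W = "{T *\<^sub>v x | x. x \<in> carrier_vec e}"
  have "?K = {0\<^sub>v e} \<or> ?K = carrier_vec e"
  proof (rule is_irrepD(2)[OF s is_subspace_kernel[OF T]])
    fix g v assume g: "g \<in> carrier G" and v: "v \<in> ?K"
    then show "\<sigma> g *\<^sub>v v \<in> ?K" using twv[OF g, of v, symmetric] sc[OF g] mult_mat_vec_zero[OF rc[OF g]] by auto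
  qed
  then have K: "?K = {0\<^sub>v e}" using v0 by blast
  have "?W = {0\<^sub>v d} \<or> ?W = carrier_vec d"
  proof (rule is_irrepD(2)[OF r is_subspace_image[OF T]])
    fix g v assume g: "g \<in> carrier G" and v: "v \<in> ?W"
    then obtain x where x: "x \<in> carrier_vec e" "v = T *\<^sub>v x" by blast
    then have "\<rho> g *\<^sub>v v = T *\<^sub>v (\<sigma> g *\<^sub>v x)" "\<sigma> g *\<^sub>v x \<in> carrier_vec e" using twv[OF g] sc[OF g] by auto
    then show "\<rho> g *\<^sub>v v \<in> ?W" by blast
  qed
  then have W: "?W = carrier_vec d" using v0 by blast
  \<comment> \<open>Preimages of the unit vectors are the columns of a right inverse
    \<open>R\<close>.\<close>
  have "\<forall>j<d. \<exists>x\<in>carrier_vec e. T *\<^sub>v x = unit_vec d j"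
  proof (intro allI impI)
    fix j
    have "unit_vec d j \<in> ?W" unfolding W by simp
    then show "\<exists>x\<in>carrier_vec e. T *\<^sub>v x = unit_vec d j" by force
  qed
  then obtain X where X: "\<And>j. j < d \<Longrightarrow> X j \<in> carrier_vec e" "\<And>j. j < d \<Longrightarrow> T *\<^sub>v X j = unit_vec d j"
    by metis
  define R where "R = mat e d (\<lambda>(i,j). X j $ i)"
  have R: "R \<in> carrier_mat e d" by (simp add: R_def)
  have colR: "col R j = X j" if "j < d" for j using X(1)[OF that] that by (intro eq_vecI) (auto simp: R_def)
  have TR: "T * R = 1\<^sub>m d"
  proof (intro eq_matI)
    fix i j assume ij: "i < dim_row (1\<^sub>m d :: complex mat)" "j < dim_col (1\<^sub>m d :: complex mat)"
    have "(T * R) $$ (i,j) = (T *\<^sub>v X j) $ i" using ij T R colR by simp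
    then show "(T * R) $$ (i,j) = 1\<^sub>m d $$ (i,j)" using ij X(2)[of j] by simp
  qed (use T R in auto)
  \<comment> \<open>As \<open>d\<close> and \<open>e\<close> are not yet known to agree, the left
    inverse property needs its own argument: the vector R(T x) - x lies in the kernel of
    \<open>T\<close>, which is zero.\<close>
  have RT: "R * T = 1\<^sub>m e"
  proof (rule mat_eq_mult_vecI)
    fix x :: "complex vec" assume x: "x \<in> carrier_vec e"
    have RTx: "R *\<^sub>v (T *\<^sub>v x) \<in> carrier_vec e" using R T x by simp
    let ?w = "R *\<^sub>v (T *\<^sub>v x) + (-1) \<cdot>\<^sub>v x"
    have "T *\<^sub>v (R *\<^sub>v (T *\<^sub>v x)) = T *\<^sub>v x" using assoc_mult_mat_vec[OF T R, of "T *\<^sub>v x"] TR T x by simp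
    then have "T *\<^sub>v ?w = T *\<^sub>v x + (-1) \<cdot>\<^sub>v (T *\<^sub>v x)"
      using mult_add_distrib_mat_vec[OF T RTx, of "(-1) \<cdot>\<^sub>v x"] mult_mat_vec[OF T x] x by simp
    then have "T *\<^sub>v ?w = 0\<^sub>v d" using T x by (intro eq_vecI) auto
    then have "?w \<in> ?K" using RTx x by simp
    then have w: "?w = 0\<^sub>v e" unfolding K by simp
    have "R *\<^sub>v (T *\<^sub>v x) = x"
    proof (intro eq_vecI)
      fix i assume "i < dim_vec x"
      then have i: "i < e" using x by simp
      have "?w $ i = 0" using w i by simp
      then show "(R *\<^sub>v (T *\<^sub>v x)) $ i = x $ i" using i x RTx by simp
    qed (use R x in auto)
    then show "(R * T) *\<^sub>v x = 1\<^sub>m e *\<^sub>v x" using assoc_mult_mat_vec[OF R T x] x by simp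
  qed (use R T in auto)
  show "mat_trace (\<rho> g) = mat_trace (\<sigma> g)" if g: "g \<in> carrier G" for g
  proof -
    have "\<rho> g = \<rho> g * (T * R)" using TR rc[OF g] by simp
    also have "\<dots> = T * (\<sigma> g * R)"
      using assoc_mult_mat[OF rc[OF g] T R] assoc_mult_mat[OF T sc[OF g] R] tw[OF g] by simp
    finally have "mat_trace (\<rho> g) = mat_trace (\<sigma> g * R * T)"
      using mat_trace_comm[OF T, of "\<sigma> g * R"] sc[OF g] R by simp
    also have "\<sigma> g * R * T = \<sigma> g" using assoc_mult_mat[OF sc[OF g] R T] RT sc[OF g] by simp
    finally show ?thesis .
  qed
qed

lemma is_subspace_eigenspace:
  fixes T :: "complex mat"
  assumes "T \<in> carrier_mat n n"
  shows "is_subspace n {v \<in> carrier_vec n. T *\<^sub>v v = a \<cdot>\<^sub>v v}"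
  unfolding is_subspace_def using assms
  by (auto simp: mult_add_distrib_mat_vec[of _ n n] mult_mat_vec[of _ n n] smult_add_distrib_vec[of _ n]
     smult_smult_assoc mult.commute)

lemma eigenspace_invariant:
  fixes T :: "complex mat"
  assumes T: "T \<in> carrier_mat d d" and R: "R \<in> carrier_mat d d" and tw: "R * T = T * R"
    and v: "v \<in> {v \<in> carrier_vec d. T *\<^sub>v v = a \<cdot>\<^sub>v v}"
  shows "R *\<^sub>v v \<in> {v \<in> carrier_vec d. T *\<^sub>v v = a \<cdot>\<^sub>v v}"
proof -
  have v: "v \<in> carrier_vec d" "T *\<^sub>v v = a \<cdot>\<^sub>v v" using v by auto
  have "T *\<^sub>v (R *\<^sub>v v) = R *\<^sub>v (T *\<^sub>v v)"
    using assoc_mult_mat_vec[OF T R v(1)] assoc_mult_mat_vec[OF R T v(1)] tw by simp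
  then show ?thesis using v R mult_mat_vec[OF R v(1)] by simp
qed

text \<open>Over the complex numbers \<open>T\<close> has an eigenvalue, and its eigenspace is a
  nonzero invariant subspace, hence the whole space.\<close>

lemma schur_scalar:
  assumes r: "is_irrep G d \<rho>" and T: "T \<in> carrier_mat d d"
    and tw: "\<And>g. g \<in> carrier G \<Longrightarrow> \<rho> g * T = T * \<rho> g"
  obtains a where "T = a \<cdot>\<^sub>m 1\<^sub>m d"
proof -
  note rD = is_repD[OF is_irrepD(1)[OF r]]
  obtain a where "eigenvalue T a" using spectrum_non_empty[OF T rD(1)] by (auto simp: spectrum_def)
  then obtain v where v: "v \<in> carrier_vec d" "v \<noteq> 0\<^sub>v d" "T *\<^sub>v v = a \<cdot>\<^sub>v v"
    using T unfolding eigenvalue_def eigenvector_def by auto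
  let ?W = "{v \<in> carrier_vec d. T *\<^sub>v v = a \<cdot>\<^sub>v v}"
  have "?W = {0\<^sub>v d} \<or> ?W = carrier_vec d"
    by (rule is_irrepD(2)[OF r is_subspace_eigenspace[OF T]]) (rule eigenspace_invariant[OF T rD(2) tw])
  then have W: "?W = carrier_vec d" using v by blast
  have "T = a \<cdot>\<^sub>m 1\<^sub>m d"
  proof (rule mat_eq_mult_vecI[OF T])
    fix x :: "complex vec" assume x: "x \<in> carrier_vec d"
    have "(a \<cdot>\<^sub>m 1\<^sub>m d) *\<^sub>v x = a \<cdot>\<^sub>v x" using x
      by (intro eq_vecI) auto
    moreover have "T *\<^sub>v x = a \<cdot>\<^sub>v x" using W x by blast
    ultimately show "T *\<^sub>v x = (a \<cdot>\<^sub>m 1\<^sub>m d) *\<^sub>v x" by simp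
  qed simp
  then show ?thesis by (rule that)
qed

section \<open>Orthogonality of irreducible characters\<close>

definition unit_mat :: "nat \<Rightarrow> nat \<Rightarrow> nat \<Rightarrow> nat \<Rightarrow> complex mat" where
  "unit_mat d e i j = mat d e (\<lambda>(p,q). if p = i \<and> q = j then 1 else 0)"

lemma unit_mat_carrier [simp]: "unit_mat d e i j \<in> carrier_mat d e"
  by (simp add: unit_mat_def)

text \<open>Inserting an elementary matrix isolates a single product of coefficients. This is how
  products of traces become entries of averaged matrices.\<close>

lemma mult_unit_mat_mult:
  assumes A: "A \<in> carrier_mat d d" and B: "B \<in> carrier_mat e e" and i: "i < d" "a < d" and j: "j < e" "b < e"
  shows "(A * unit_mat d e i j * B) $$ (a,b) = A $$ (a,i) * B $$ (j,b)"
proof -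
  have 1: "(A * unit_mat d e i j) $$ (a,q) = (if q = j then A $$ (a,i) else 0)" if "q < e" for q
    using that A i j by (auto simp: unit_mat_def scalar_prod_def atLeast0LessThan if_distrib[of "\<lambda>x. _ * x"] cong: if_cong)
  have "(A * unit_mat d e i j * B) $$ (a,b) = (\<Sum>q<e. (A * unit_mat d e i j) $$ (a,q) * B $$ (q,b))"
    using A B i j by (auto simp: unit_mat_def scalar_prod_def atLeast0LessThan)
  also have "\<dots> = (\<Sum>q<e. (if q = j then A $$ (a,i) * B $$ (j,b) else 0))"
    by (intro sum.cong) (auto simp: 1)
  also have "\<dots> = A $$ (a,i) * B $$ (j,b)" using j by simp
  finally show ?thesis .
qed

locale fin_group = group +
  assumes fin: "finite (carrier G)"
begin

lemma inv_mult_cancel [simp]: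
  assumes "h \<in> carrier G" "a \<in> carrier G"
  shows "inv h \<otimes> (h \<otimes> a) = a" "h \<otimes> (inv h \<otimes> a) = a"
  using assms by (simp_all add: m_assoc[symmetric])

lemma bij_mult_left: "h \<in> carrier G \<Longrightarrow> bij_betw (\<lambda>g. h \<otimes> g) (carrier G) (carrier G)"
  by (rule bij_betw_byWitness[where f' = "\<lambda>g. inv h \<otimes> g"]) (auto simp: m_assoc[symmetric])

lemma bij_conj: "h \<in> carrier G \<Longrightarrow> bij_betw (\<lambda>g. h \<otimes> g \<otimes> inv h) (carrier G) (carrier G)"
  by (rule bij_betw_byWitness[where f' = "\<lambda>g. inv h \<otimes> g \<otimes> h"]) (auto simp: m_assoc)

lemma order_pos: "card (carrier G) > 0"
  using fin one_closed by (auto simp: card_gt_0_iff)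

lemma rep_pow:
  assumes "is_rep G d \<rho>" "g \<in> carrier G"
  shows "\<rho> (g [^] (k::nat)) = \<rho> g ^\<^sub>m k"
  using assms is_repD[OF assms(1)] by (induction k) auto

text \<open>By Lagrange the power of \<open>g\<close> with exponent |G| is trivial, so
  \<open>\<rho> g\<close> has finite order and the inverse of \<open>g\<close> is its power with
  exponent |G| - 1.\<close>

lemma
  assumes r: "is_rep G d \<rho>" and g: "g \<in> carrier G"
  shows norm_trace_rep_le: "cmod (mat_trace (\<rho> g)) \<le> real d"
    and trace_rep_inv: "mat_trace (\<rho> (inv g)) = cnj (mat_trace (\<rho> g))"
proof -
  let ?k = "Coset.order G"
  have k: "?k > 0" using order_pos by (simp add: Coset.order_def)
  have one: "g [^] ?k = \<one>" using pow_order_eq_1[OF g] .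
  have "g [^] (?k - 1) \<otimes> g = \<one>" using one k g by (metis Suc_diff_1 nat_pow_Suc)
  then have inv: "inv g = g [^] (?k - 1)" using g by (intro inv_equality) auto
  have A: "\<rho> g \<in> carrier_mat d d" "\<rho> g ^\<^sub>m ?k = 1\<^sub>m d"
    using is_repD[OF r] g rep_pow[OF r g, of ?k] one by auto
  show "cmod (mat_trace (\<rho> g)) \<le> real d" using mat_trace_finite_order(1)[OF A(1) k A(2)] .
  show "mat_trace (\<rho> (inv g)) = cnj (mat_trace (\<rho> g))"
    using mat_trace_finite_order(2)[OF A(1) k A(2)] unfolding inv rep_pow[OF r g] .
qed

text \<open>Substituting \<open>h \<otimes> g\<close> for \<open>g\<close> in the average turns the
  factor \<open>\<rho> h\<close> on the left into \<open>\<sigma> h\<close> on the right.\<close>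

lemma averaged_intertwiner:
  assumes r: "is_rep G d \<rho>" and s: "is_rep G e \<sigma>" and A: "A \<in> carrier_mat d e" and h: "h \<in> carrier G"
  shows "\<rho> h * mat_sum d e (carrier G) (\<lambda>g. \<rho> g * A * \<sigma> (inv g)) =
    mat_sum d e (carrier G) (\<lambda>g. \<rho> g * A * \<sigma> (inv g)) * \<sigma> h"
proof -
  have rc: "\<rho> g \<in> carrier_mat d d" and sc: "\<sigma> g \<in> carrier_mat e e" if "g \<in> carrier G" for g
    using is_repD(2)[OF r] is_repD(2)[OF s] that by auto
  have c: "\<rho> g * A * \<sigma> (inv g) \<in> carrier_mat d e" if "g \<in> carrier G" for g
    using mult_carrier_mat[OF mult_carrier_mat[OF rc[OF that] A] sc] that by simp
  have "\<rho> h * mat_sum d e (carrier G) (\<lambda>g. \<rho> g * A * \<sigma> (inv g)) =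
      mat_sum d e (carrier G) (\<lambda>g. \<rho> h * (\<rho> g * A * \<sigma> (inv g)))"
    by (rule mat_sum_mult_left[OF rc[OF h] c])
  also have "\<dots> = mat_sum d e (carrier G) (\<lambda>g. \<rho> g * A * \<sigma> (inv g) * \<sigma> h)"
  proof (rule mat_sum_reindex[OF bij_mult_left[OF h], symmetric])
    fix g assume g: "g \<in> carrier G"
    have gi: "inv g \<in> carrier G" "inv (h \<otimes> g) \<in> carrier G" using g h by auto
    have rgA: "\<rho> g * A \<in> carrier_mat d e" using rc[OF g] A by simp
    have "inv (h \<otimes> g) \<otimes> h = inv g" using g h by (simp add: inv_mult_group m_assoc)
    then have "\<sigma> (inv (h \<otimes> g)) * \<sigma> h = \<sigma> (inv g)" using is_repD(3)[OF s gi(2) h] by simp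
    moreover have "\<rho> (h \<otimes> g) * A = \<rho> h * (\<rho> g * A)"
      using is_repD(3)[OF r h g] assoc_mult_mat[OF rc[OF h] rc[OF g] A] by simp
    moreover have "\<rho> (h \<otimes> g) * A * \<sigma> (inv (h \<otimes> g)) * \<sigma> h = \<rho> (h \<otimes> g) * A * (\<sigma> (inv (h \<otimes> g)) * \<sigma> h)"
      using assoc_mult_mat[OF _ sc[OF gi(2)] sc[OF h], of "\<rho> (h \<otimes> g) * A" d] rc[of "h \<otimes> g"] A g h by simp
    ultimately show "\<rho> (h \<otimes> g) * A * \<sigma> (inv (h \<otimes> g)) * \<sigma> h = \<rho> h * (\<rho> g * A * \<sigma> (inv g))"
      using assoc_mult_mat[OF rc[OF h] rgA sc[OF gi(1)]] by simp
  qed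
  also have "\<dots> = mat_sum d e (carrier G) (\<lambda>g. \<rho> g * A * \<sigma> (inv g)) * \<sigma> h"
    by (rule mat_sum_mult_right[OF sc[OF h] c, symmetric])
  finally show ?thesis .
qed

text \<open>The (i,j) entry with the (i,j) elementary matrix inserted is the product of the diagonal
  entries \<open>i\<close> of \<open>\<rho> g\<close> and \<open>j\<close> of
  \<open>\<sigma> (inv g)\<close>. An inner product of characters is thus expressed through
  intertwiners, to which Schur's lemma applies.\<close>

lemma sum_trace_mult_trace:
  assumes r: "is_rep G d \<rho>" and s: "is_rep G e \<sigma>"
  shows "(\<Sum>g\<in>carrier G. mat_trace (\<rho> g) * mat_trace (\<sigma> (inv g))) =
    (\<Sum>i<d. \<Sum>j<e. mat_sum d e (carrier G) (\<lambda>g. \<rho> g * unit_mat d e i j * \<sigma> (inv g)) $$ (i,j))"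
proof -
  have rc: "\<rho> g \<in> carrier_mat d d" and sc: "\<sigma> (inv g) \<in> carrier_mat e e" if "g \<in> carrier G" for g
    using is_repD(2)[OF r] is_repD(2)[OF s] that by auto
  have "(\<Sum>i<d. \<Sum>j<e. mat_sum d e (carrier G) (\<lambda>g. \<rho> g * unit_mat d e i j * \<sigma> (inv g)) $$ (i,j)) =
      (\<Sum>i<d. \<Sum>j<e. \<Sum>g\<in>carrier G. \<rho> g $$ (i,i) * \<sigma> (inv g) $$ (j,j))"
    by (intro sum.cong refl) (use mult_unit_mat_mult[OF rc sc] in \<open>auto simp: index_mat_sum intro!: sum.cong\<close>)
  also have "\<dots> = (\<Sum>i<d. \<Sum>g\<in>carrier G. \<Sum>j<e. \<rho> g $$ (i,i) * \<sigma> (inv g) $$ (j,j))"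
    by (intro sum.cong refl sum.swap)
  also have "\<dots> = (\<Sum>g\<in>carrier G. \<Sum>i<d. \<Sum>j<e. \<rho> g $$ (i,i) * \<sigma> (inv g) $$ (j,j))"
    by (rule sum.swap)
  also have "\<dots> = (\<Sum>g\<in>carrier G. mat_trace (\<rho> g) * mat_trace (\<sigma> (inv g)))"
    by (intro sum.cong refl) (auto simp: mat_trace_def sum_product carrier_matD[OF rc] carrier_matD[OF sc])
  finally show ?thesis by simp
qed

lemma irrep_orthogonal_distinct:
  assumes r: "is_irrep G d \<rho>" and s: "is_irrep G e \<sigma>"
    and ne: "\<exists>g\<in>carrier G. mat_trace (\<rho> g) \<noteq> mat_trace (\<sigma> g)"
  shows "(\<Sum>g\<in>carrier G. mat_trace (\<rho> g) * mat_trace (\<sigma> (inv g))) = 0"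
proof -
  note rr = is_irrepD(1)[OF r] and ss = is_irrepD(1)[OF s]
  have "mat_sum d e (carrier G) (\<lambda>g. \<rho> g * unit_mat d e i j * \<sigma> (inv g)) = 0\<^sub>m d e" for i j
    using schur_distinct[OF r s mat_sum_carrier averaged_intertwiner[OF rr ss unit_mat_carrier], of i j] ne by blast
  then show ?thesis unfolding sum_trace_mult_trace[OF rr ss] by simp
qed

text \<open>Each averaged matrix is a scalar \<open>a\<close>. Its trace \<open>a * d\<close> is |G|
  times the trace of an elementary matrix, so \<open>a\<close> is |G| / d for \<open>i = j\<close>
  and 0 otherwise; the \<open>d\<close> diagonal contributions add up to |G|.\<close>

lemma irrep_norm:
  assumes r: "is_irrep G d \<rho>"
  shows "(\<Sum>g\<in>carrier G. mat_trace (\<rho> g) * mat_trace (\<rho> (inv g))) = of_nat (card (carrier G))"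
proof -
  note rr = is_irrepD(1)[OF r]
  note rD = is_repD[OF rr]
  let ?M = "\<lambda>i j. mat_sum d d (carrier G) (\<lambda>g. \<rho> g * unit_mat d d i j * \<rho> (inv g))"
  have "?M i j $$ (i,j) = (if i = j then of_nat (card (carrier G)) / of_nat d else 0)" if ij: "i < d" "j < d" for i j
  proof -
    obtain a where a: "?M i j = a \<cdot>\<^sub>m 1\<^sub>m d"
      using schur_scalar[OF r mat_sum_carrier averaged_intertwiner[OF rr rr unit_mat_carrier]] by blast
    have "mat_trace (?M i j) = (\<Sum>g\<in>carrier G. mat_trace (\<rho> g * unit_mat d d i j * \<rho> (inv g)))"
      by (rule mat_trace_sum)
        (use mult_carrier_mat[OF mult_carrier_mat[OF rD(2) unit_mat_carrier] rD(2)] in simp)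
    also have "\<dots> = (\<Sum>g\<in>carrier G. mat_trace (unit_mat d d i j))"
    proof (rule sum.cong[OF refl])
      fix g assume g: "g \<in> carrier G"
      have c: "\<rho> g \<in> carrier_mat d d" "\<rho> (inv g) \<in> carrier_mat d d" using rD(2) g by auto
      have "\<rho> (inv g) * \<rho> g = 1\<^sub>m d" using rD(3)[of "inv g" g] rD(4) g by simp
      then have "\<rho> (inv g) * (\<rho> g * unit_mat d d i j) = unit_mat d d i j"
        using assoc_mult_mat[OF c(2) c(1) unit_mat_carrier, of d i j] left_mult_one_mat[OF unit_mat_carrier] by metis
      then show "mat_trace (\<rho> g * unit_mat d d i j * \<rho> (inv g)) = mat_trace (unit_mat d d i j)"
        using mat_trace_comm[of "\<rho> g * unit_mat d d i j" d d "\<rho> (inv g)"] c by simp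
    qed
    also have "\<dots> = of_nat (card (carrier G)) * (if i = j then 1 else 0)"
      using ij by (auto simp: mat_trace_def unit_mat_def)
    finally have "a * of_nat d = of_nat (card (carrier G)) * (if i = j then 1 else 0)"
      unfolding a using mat_trace_smult[of "1\<^sub>m d" d a] by simp
    then have "a = (if i = j then of_nat (card (carrier G)) / of_nat d else 0)"
      using rD(1) by (auto simp: field_simps)
    then show ?thesis unfolding a using ij by auto
  qed
  then have "(\<Sum>i<d. \<Sum>j<d. ?M i j $$ (i,j)) =
      (\<Sum>i<d. \<Sum>j<d. (if i = j then of_nat (card (carrier G)) / of_nat d else 0))" by simp
  also have "\<dots> = of_nat (card (carrier G))" using rD(1) by simp
  finally show ?thesis unfolding sum_trace_mult_trace[OF rr rr] .
qed

lemma IrrE: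
  assumes "\<chi> \<in> Irr G"
  obtains d \<rho> where "is_irrep G d \<rho>" "\<And>g. g \<in> carrier G \<Longrightarrow> \<chi> g = mat_trace (\<rho> g)"
    "\<chi> \<one> = of_nat d" "char_deg G \<chi> = real d" "d > 0"
proof -
  obtain d \<rho> where r: "is_irrep G d \<rho>" and \<chi>: "\<chi> = (\<lambda>g. if g \<in> carrier G then mat_trace (\<rho> g) else 0)"
    using assms by (auto simp: Irr_def)
  then have "\<chi> \<one> = of_nat d" "d > 0" using is_repD[OF is_irrepD(1)[OF r]] by auto
  then show ?thesis using that[OF r] \<chi> by (simp add: char_deg_def)
qed

lemma Irr_norm_le: "\<chi> \<in> Irr G \<Longrightarrow> g \<in> carrier G \<Longrightarrow> cmod (\<chi> g) \<le> char_deg G \<chi>"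
  by (erule IrrE) (use norm_trace_rep_le is_irrepD(1) in fastforce)

lemma Irr_one: "\<chi> \<in> Irr G \<Longrightarrow> \<chi> \<one> = of_real (char_deg G \<chi>)"
  by (erule IrrE) simp

lemma char_deg_ge_1: "\<chi> \<in> Irr G \<Longrightarrow> char_deg G \<chi> \<ge> 1"
  by (erule IrrE) simp

lemma Irr_conj:
  assumes "\<chi> \<in> Irr G" and g: "g \<in> carrier G" and x: "x \<in> carrier G"
  shows "\<chi> (x \<otimes> g \<otimes> inv x) = \<chi> g"
proof -
  obtain d \<rho> where r: "is_irrep G d \<rho>" and \<chi>: "\<And>g. g \<in> carrier G \<Longrightarrow> \<chi> g = mat_trace (\<rho> g)"
    using assms(1) by (metis IrrE)
  note rD = is_repD[OF is_irrepD(1)[OF r]]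
  have xi: "inv x \<in> carrier G" using x by simp
  have "\<chi> (x \<otimes> g \<otimes> inv x) = mat_trace (\<rho> (x \<otimes> g) * \<rho> (inv x))"
    using \<chi>[of "x \<otimes> g \<otimes> inv x"] rD(3)[of "x \<otimes> g" "inv x"] g x by simp
  also have "\<dots> = mat_trace (\<rho> (inv x) * \<rho> (x \<otimes> g))"
    by (rule mat_trace_comm[of _ d d]) (use rD(2) g x in auto)
  also have "\<rho> (inv x) * \<rho> (x \<otimes> g) = \<rho> (inv x \<otimes> (x \<otimes> g))" using rD(3)[of "inv x" "x \<otimes> g"] g x by simp
  also have "inv x \<otimes> (x \<otimes> g) = g" using g x by (simp add: m_assoc[symmetric])
  finally show ?thesis using \<chi>[OF g] by simp
qed

lemma Irr_orthogonal:
  assumes c: "\<chi> \<in> Irr G" and p: "\<psi> \<in> Irr G"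
  shows "(\<Sum>g\<in>carrier G. \<chi> g * cnj (\<psi> g)) = (if \<chi> = \<psi> then of_nat (card (carrier G)) else 0)"
proof -
  obtain d \<rho> where r: "is_irrep G d \<rho>" and \<chi>: "\<chi> = (\<lambda>g. if g \<in> carrier G then mat_trace (\<rho> g) else 0)"
    using c by (auto simp: Irr_def)
  obtain e \<sigma> where s: "is_irrep G e \<sigma>" and \<psi>: "\<psi> = (\<lambda>g. if g \<in> carrier G then mat_trace (\<sigma> g) else 0)"
    using p by (auto simp: Irr_def)
  have "(\<Sum>g\<in>carrier G. \<chi> g * cnj (\<psi> g)) = (\<Sum>g\<in>carrier G. mat_trace (\<rho> g) * mat_trace (\<sigma> (inv g)))"
    using trace_rep_inv[OF is_irrepD(1)[OF s]] by (intro sum.cong) (auto simp: \<chi> \<psi>)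
  \<comment> \<open>Both characters are 0 off the carrier, so if they differ as functions they
    differ at a group element.\<close>
  moreover have "\<exists>g\<in>carrier G. mat_trace (\<rho> g) \<noteq> mat_trace (\<sigma> g)" if "\<chi> \<noteq> \<psi>"
    using that unfolding \<chi> \<psi> by (metis)
  moreover have "(\<Sum>g\<in>carrier G. \<chi> g * cnj (\<psi> g)) = of_nat (card (carrier G))" if "\<chi> = \<psi>"
  proof -
    have "(\<Sum>g\<in>carrier G. \<chi> g * cnj (\<chi> g)) = (\<Sum>g\<in>carrier G. mat_trace (\<rho> g) * mat_trace (\<rho> (inv g)))"
      using trace_rep_inv[OF is_irrepD(1)[OF r]] by (intro sum.cong) (auto simp: \<chi>)
    then show ?thesis using irrep_norm[OF r] that by simp
  qed
  ultimately show ?thesis using irrep_orthogonal_distinct[OF r s] by auto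
qed

section \<open>Completeness of the irreducible characters among class functions\<close>

text \<open>Conjugation by \<open>h\<close> permutes the summands and leaves the coefficients
  \<open>f g\<close> unchanged.\<close>

lemma class_sum_commute:
  assumes r: "is_rep G d \<rho>" and h: "h \<in> carrier G"
    and f: "\<And>g. g \<in> carrier G \<Longrightarrow> f (h \<otimes> g \<otimes> inv h) = f g"
  shows "\<rho> h * mat_sum d d (carrier G) (\<lambda>g. f g \<cdot>\<^sub>m \<rho> (inv g)) =
    mat_sum d d (carrier G) (\<lambda>g. f g \<cdot>\<^sub>m \<rho> (inv g)) * \<rho> h"
proof -
  note rD = is_repD[OF r]
  have c: "f g \<cdot>\<^sub>m \<rho> (inv g) \<in> carrier_mat d d" if "g \<in> carrier G" for g using rD(2) that by simp
  have "mat_sum d d (carrier G) (\<lambda>g. f g \<cdot>\<^sub>m \<rho> (inv g)) * \<rho> h =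
      mat_sum d d (carrier G) (\<lambda>g. f g \<cdot>\<^sub>m \<rho> (inv g) * \<rho> h)"
    by (rule mat_sum_mult_right[OF rD(2)[OF h] c])
  also have "\<dots> = mat_sum d d (carrier G) (\<lambda>g. \<rho> h * (f g \<cdot>\<^sub>m \<rho> (inv g)))"
  proof (rule mat_sum_reindex[OF bij_conj[OF h]])
    fix g assume g: "g \<in> carrier G"
    have gi: "inv g \<in> carrier G" "inv (h \<otimes> g \<otimes> inv h) \<in> carrier G" using g h by auto
    have "inv (h \<otimes> g \<otimes> inv h) \<otimes> h = h \<otimes> inv g"
      using g h by (simp add: inv_mult_group m_assoc)
    then have "\<rho> (inv (h \<otimes> g \<otimes> inv h)) * \<rho> h = \<rho> h * \<rho> (inv g)"
      using rD(3)[OF gi(2) h] rD(3)[OF h gi(1)] by simp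
    then show "f (h \<otimes> g \<otimes> inv h) \<cdot>\<^sub>m \<rho> (inv (h \<otimes> g \<otimes> inv h)) * \<rho> h = \<rho> h * (f g \<cdot>\<^sub>m \<rho> (inv g))"
      using f[OF g] mult_smult_assoc_mat[OF rD(2)[OF gi(2)] rD(2)[OF h]]
        mult_smult_distrib[OF rD(2)[OF h] rD(2)[OF gi(1)]] by simp
  qed
  also have "\<dots> = \<rho> h * mat_sum d d (carrier G) (\<lambda>g. f g \<cdot>\<^sub>m \<rho> (inv g))"
    by (rule mat_sum_mult_left[OF rD(2)[OF h] c, symmetric])
  finally show ?thesis by simp
qed

text \<open>By Schur's lemma the operator is a scalar. Its trace is the sum in \<open>o\<close>, so
  the scalar is zero because the degree is positive.\<close>

lemma class_sum_irrep_eq_0: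
  assumes r: "is_irrep G d \<rho>"
    and f: "\<And>g h. g \<in> carrier G \<Longrightarrow> h \<in> carrier G \<Longrightarrow> f (h \<otimes> g \<otimes> inv h) = f g"
    and o: "(\<Sum>g\<in>carrier G. f g * mat_trace (\<rho> (inv g))) = 0"
  shows "mat_sum d d (carrier G) (\<lambda>g. f g \<cdot>\<^sub>m \<rho> (inv g)) = 0\<^sub>m d d"
proof -
  note rr = is_irrepD(1)[OF r]
  note rD = is_repD[OF rr]
  let ?M = "mat_sum d d (carrier G) (\<lambda>g. f g \<cdot>\<^sub>m \<rho> (inv g))"
  obtain a where a: "?M = a \<cdot>\<^sub>m 1\<^sub>m d"
    using schur_scalar[OF r mat_sum_carrier class_sum_commute[OF rr]] f by blast
  have "mat_trace ?M = (\<Sum>g\<in>carrier G. mat_trace (f g \<cdot>\<^sub>m \<rho> (inv g)))"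
    by (rule mat_trace_sum) (use rD in auto)
  also have "\<dots> = (\<Sum>g\<in>carrier G. f g * mat_trace (\<rho> (inv g)))"
    by (intro sum.cong refl mat_trace_smult) (use rD in auto)
  finally have "a * of_nat d = 0" unfolding a using mat_trace_smult[of "1\<^sub>m d" d a] o by simp
  then have "a = 0" using rD(1) by simp
  then show ?thesis unfolding a by (intro eq_matI) auto
qed

text \<open>Transports the action of \<open>f\<close> from \<open>\<rho>\<close> to an embedded
  \<open>\<sigma>\<close>, where irreducibility can be exploited.\<close>

lemma class_sum_intertwine:
  assumes r: "is_rep G d \<rho>" and s: "is_rep G m \<sigma>" and T: "T \<in> carrier_mat d m"
    and tw: "\<And>g. g \<in> carrier G \<Longrightarrow> \<rho> g * T = T * \<sigma> g"
  shows "mat_sum d d (carrier G) (\<lambda>g. f g \<cdot>\<^sub>m \<rho> (inv g)) * T =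
    T * mat_sum m m (carrier G) (\<lambda>g. f g \<cdot>\<^sub>m \<sigma> (inv g))"
proof -
  have rc: "\<rho> (inv g) \<in> carrier_mat d d" and sc: "\<sigma> (inv g) \<in> carrier_mat m m" if "g \<in> carrier G" for g
    using is_repD(2)[OF r] is_repD(2)[OF s] that by auto
  have "mat_sum d d (carrier G) (\<lambda>g. f g \<cdot>\<^sub>m \<rho> (inv g)) * T =
      mat_sum d m (carrier G) (\<lambda>g. f g \<cdot>\<^sub>m \<rho> (inv g) * T)"
    by (rule mat_sum_mult_right[OF T]) (use rc in auto)
  also have "\<dots> = mat_sum d m (carrier G) (\<lambda>g. T * (f g \<cdot>\<^sub>m \<sigma> (inv g)))"
  proof (rule mat_sum_cong)
    fix g assume g: "g \<in> carrier G"
    show "f g \<cdot>\<^sub>m \<rho> (inv g) * T = T * (f g \<cdot>\<^sub>m \<sigma> (inv g))"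
      using mult_smult_assoc_mat[OF rc[OF g] T] mult_smult_distrib[OF T sc[OF g]] tw[of "inv g"] g by simp
  qed
  also have "\<dots> = T * mat_sum m m (carrier G) (\<lambda>g. f g \<cdot>\<^sub>m \<sigma> (inv g))"
    by (rule mat_sum_mult_left[OF T, symmetric]) (use sc in auto)
  finally show ?thesis .
qed

text \<open>Permutation matrices of left multiplication with respect to an enumeration
  \<open>e\<close> of the group. The trace counts the fixed points, and only the identity has
  any.\<close>

lemma regular_rep_exists:
  obtains \<rho> where "is_rep G (card (carrier G)) \<rho>"
    "\<And>g. g \<in> carrier G \<Longrightarrow> mat_trace (\<rho> g) = (if g = \<one> then of_nat (card (carrier G)) else 0)"
proof -
  let ?n = "card (carrier G)"
  obtain e where e: "bij_betw e {..<?n} (carrier G)"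
    using ex_bij_betw_nat_finite[OF fin] by (auto simp: atLeast0LessThan)
  have ec: "i < ?n \<Longrightarrow> e i \<in> carrier G" for i using e by (auto dest: bij_betw_apply)
  have inj: "i < ?n \<Longrightarrow> j < ?n \<Longrightarrow> e i = e j \<longleftrightarrow> i = j" for i j
    using e by (auto simp: bij_betw_def inj_on_def)
  define \<rho> where "\<rho> g = mat ?n ?n (\<lambda>(i,j). if e i = g \<otimes> e j then (1::complex) else 0)" for g
  have "\<rho> (g \<otimes> h) = \<rho> g * \<rho> h" if g: "g \<in> carrier G" and h: "h \<in> carrier G" for g h
  proof (intro eq_matI)
    fix i j assume "i < dim_row (\<rho> g * \<rho> h)" "j < dim_col (\<rho> g * \<rho> h)"
    then have ij: "i < ?n" "j < ?n" by (auto simp: \<rho>_def)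
    have "h \<otimes> e j \<in> carrier G" using h ec[OF ij(2)] by simp
    then obtain k where k: "k < ?n" "e k = h \<otimes> e j" using e by (metis bij_betw_imp_surj_on imageE lessThan_iff)
    have "(\<rho> g * \<rho> h) $$ (i,j) = (\<Sum>l<?n. (if e i = g \<otimes> e l then 1 else 0) * (if e l = h \<otimes> e j then 1 else 0))"
      using ij by (simp add: \<rho>_def scalar_prod_def atLeast0LessThan)
    also have "\<dots> = (\<Sum>l<?n. if l = k then (if e i = g \<otimes> e l then 1 else 0) else 0)"
      using inj k by (intro sum.cong) (auto simp: k(2)[symmetric])
    also have "\<dots> = (if e i = g \<otimes> (h \<otimes> e j) then 1 else 0)" using k by simp
    finally show "\<rho> (g \<otimes> h) $$ (i,j) = (\<rho> g * \<rho> h) $$ (i,j)"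
      using ij g h ec[OF ij(2)] by (simp add: \<rho>_def m_assoc)
  qed (auto simp: \<rho>_def)
  moreover have "\<rho> \<one> = 1\<^sub>m ?n"
    by (intro eq_matI) (use ec inj in \<open>auto simp: \<rho>_def\<close>)
  ultimately have "is_rep G ?n \<rho>" using order_pos by (auto simp: is_rep_def \<rho>_def)
  moreover have "mat_trace (\<rho> g) = (if g = \<one> then of_nat ?n else 0)" if g: "g \<in> carrier G" for g
  proof -
    have "e i = g \<otimes> e i \<longleftrightarrow> g = \<one>" if "i < ?n" for i
      using r_cancel_one'[OF ec[OF that] g] .
    then show ?thesis by (simp add: mat_trace_def \<rho>_def)
  qed
  ultimately show ?thesis by (rule that)
qed

text \<open>With \<open>M\<close> the action of \<open>f\<close> on the regular representation, \<open>M M\<^sup>*\<close> has trace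
  \<open>|G| \<Sum>|f g|\<^sup>2\<close>. Were this nonzero, some eigenspace of \<open>M M\<^sup>*\<close> for a nonzero eigenvalue
  would contain an irreducible representation, on which \<open>M\<close> vanishes by Schur's lemma.\<close>

lemma class_function_eq_0:
  assumes f: "\<And>g h. g \<in> carrier G \<Longrightarrow> h \<in> carrier G \<Longrightarrow> f (h \<otimes> g \<otimes> inv h) = f g"
    and o: "\<And>\<chi>. \<chi> \<in> Irr G \<Longrightarrow> (\<Sum>g\<in>carrier G. f g * cnj (\<chi> g)) = 0"
    and g: "g \<in> carrier G"
  shows "f g = 0"
proof -
  let ?n = "card (carrier G)"
  obtain \<rho> where r: "is_rep G ?n \<rho>"
    and tr: "\<And>g. g \<in> carrier G \<Longrightarrow> mat_trace (\<rho> g) = (if g = \<one> then of_nat ?n else 0)"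
    using regular_rep_exists by blast
  note rD = is_repD[OF r]
  \<comment> \<open>These are the coefficients that the adjoint of \<open>M\<close> has when the
    representation is by unitary matrices. The proof needs only that they are again a class function
    and that the trace of \<open>M * M'\<close> is computable.\<close>
  define f' where "f' g = cnj (f (inv g))" for g
  have f': "f' (h \<otimes> g \<otimes> inv h) = f' g" if "g \<in> carrier G" "h \<in> carrier G" for g h
    using f[of "inv g" h] that by (simp add: f'_def inv_mult_group m_assoc)
  define M where "M = mat_sum ?n ?n (carrier G) (\<lambda>g. f g \<cdot>\<^sub>m \<rho> (inv g))"
  define M' where "M' = mat_sum ?n ?n (carrier G) (\<lambda>g. f' g \<cdot>\<^sub>m \<rho> (inv g))"
  have MC: "M \<in> carrier_mat ?n ?n" "M' \<in> carrier_mat ?n ?n" by (auto simp: M_def M'_def)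
  define Q where "Q = M * M'"
  have Q: "Q \<in> carrier_mat ?n ?n" using MC by (simp add: Q_def)
  have comm: "\<rho> h * Q = Q * \<rho> h" if h: "h \<in> carrier G" for h
  proof -
    have "\<rho> h * Q = M * \<rho> h * M'"
      using class_sum_commute[OF r h, of f] f h assoc_mult_mat[OF rD(2)[OF h] MC] by (simp add: Q_def M_def)
    also have "\<dots> = M * (M' * \<rho> h)"
      using class_sum_commute[OF r h, of f'] f' h assoc_mult_mat[OF MC(1) rD(2)[OF h] MC(2)] by (simp add: M'_def)
    also have "\<dots> = Q * \<rho> h" using assoc_mult_mat[OF MC rD(2)[OF h]] by (simp add: Q_def)
    finally show ?thesis .
  qed
  have trQ: "mat_trace Q = of_nat ?n * (\<Sum>g\<in>carrier G. f g * cnj (f g))"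
  proof -
    have c: "f g \<cdot>\<^sub>m \<rho> (inv g) \<in> carrier_mat ?n ?n" "f' g \<cdot>\<^sub>m \<rho> (inv g) \<in> carrier_mat ?n ?n" if "g \<in> carrier G" for g
      using rD(2) that by auto
    have "Q = mat_sum ?n ?n (carrier G) (\<lambda>g. f g \<cdot>\<^sub>m \<rho> (inv g) * M')"
      unfolding Q_def M_def by (rule mat_sum_mult_right[OF MC(2) c(1)])
    then have "mat_trace Q = (\<Sum>g\<in>carrier G. mat_trace (f g \<cdot>\<^sub>m \<rho> (inv g) * M'))"
      using mat_trace_sum[of "carrier G" "\<lambda>g. f g \<cdot>\<^sub>m \<rho> (inv g) * M'" ?n] mult_carrier_mat[OF c(1) MC(2)] by simp
    also have "\<dots> = (\<Sum>g\<in>carrier G. of_nat ?n * (f g * cnj (f g)))"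
    proof (rule sum.cong[OF refl])
      fix g assume g: "g \<in> carrier G"
      have "mat_trace (f g \<cdot>\<^sub>m \<rho> (inv g) * M') =
          mat_trace (mat_sum ?n ?n (carrier G) (\<lambda>h. f g \<cdot>\<^sub>m \<rho> (inv g) * (f' h \<cdot>\<^sub>m \<rho> (inv h))))"
        unfolding M'_def by (subst mat_sum_mult_left[OF c(1)[OF g] c(2)]) simp_all
      also have "\<dots> = (\<Sum>h\<in>carrier G. mat_trace (f g \<cdot>\<^sub>m \<rho> (inv g) * (f' h \<cdot>\<^sub>m \<rho> (inv h))))"
        by (rule mat_trace_sum) (use mult_carrier_mat[OF c(1)[OF g] c(2)] in blast)
      also have "\<dots> = (\<Sum>h\<in>carrier G. if h = inv g then of_nat ?n * (f g * cnj (f g)) else 0)"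
      proof (rule sum.cong[OF refl])
        fix h assume h: "h \<in> carrier G"
        have ii: "inv g \<in> carrier G" "inv h \<in> carrier G" using g h by auto
        have "f g \<cdot>\<^sub>m \<rho> (inv g) * (f' h \<cdot>\<^sub>m \<rho> (inv h)) = f g \<cdot>\<^sub>m (f' h \<cdot>\<^sub>m (\<rho> (inv g) * \<rho> (inv h)))"
          using mult_smult_assoc_mat[OF rD(2)[OF ii(1)] c(2)[OF h], of "f g"]
            mult_smult_distrib[OF rD(2)[OF ii(1)] rD(2)[OF ii(2)]] by simp
        also have "\<rho> (inv g) * \<rho> (inv h) = \<rho> (inv g \<otimes> inv h)" using rD(3)[OF ii] by simp
        finally have "mat_trace (f g \<cdot>\<^sub>m \<rho> (inv g) * (f' h \<cdot>\<^sub>m \<rho> (inv h))) = f g * (f' h * mat_trace (\<rho> (inv g \<otimes> inv h)))"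
          using mat_trace_smult[of "f' h \<cdot>\<^sub>m \<rho> (inv g \<otimes> inv h)" ?n "f g"]
            mat_trace_smult[of "\<rho> (inv g \<otimes> inv h)" ?n "f' h"] rD(2)[of "inv g \<otimes> inv h"] ii by simp
        \<comment> \<open>The regular character keeps only \<open>h = inv g\<close>, where
          \<open>f' h\<close> is the conjugate of \<open>f g\<close>; hence a sum of squared
          moduli.\<close>
        also have "mat_trace (\<rho> (inv g \<otimes> inv h)) = (if h = inv g then of_nat ?n else 0)"
          using tr[of "inv g \<otimes> inv h"] ii g h by (metis inv_inv inv_equality m_closed r_inv)
        finally show "mat_trace (f g \<cdot>\<^sub>m \<rho> (inv g) * (f' h \<cdot>\<^sub>m \<rho> (inv h))) =
            (if h = inv g then of_nat ?n * (f g * cnj (f g)) else 0)"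
          using g by (simp add: f'_def)
      qed
      also have "\<dots> = of_nat ?n * (f g * cnj (f g))" using g fin by simp
      finally show "mat_trace (f g \<cdot>\<^sub>m \<rho> (inv g) * M') = of_nat ?n * (f g * cnj (f g))" .
    qed
    finally show ?thesis by (simp add: sum_distrib_left)
  qed
  have "mat_trace Q = 0"
  proof (rule ccontr)
    assume nz: "mat_trace Q \<noteq> 0"
    obtain es where "length es = ?n" and es: "\<And>k. mat_trace (Q ^\<^sub>m k) = (\<Sum>e\<leftarrow>es. e ^ k)"
        "\<And>e. e \<in> set es \<Longrightarrow> eigenvalue Q e"
      using mat_trace_pow_eigenvalues[OF Q] by blast
    \<comment> \<open>The trace is the sum of the list, so it cannot be nonzero if every eigenvalue
      is zero.\<close>
    have "\<exists>e\<in>set es. e \<noteq> 0"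
    proof (rule ccontr)
      assume "\<not> ?thesis"
      then have "(\<Sum>e\<leftarrow>es. e ^ 1) = 0" by (induction es) auto
      then show False using es(1)[of 1] nz Q by simp
    qed
    then obtain a where a: "eigenvalue Q a" "a \<noteq> 0" using es(2) by blast
    then obtain v where v: "v \<in> carrier_vec ?n" "v \<noteq> 0\<^sub>v ?n" "Q *\<^sub>v v = a \<cdot>\<^sub>v v"
      using Q unfolding eigenvalue_def eigenvector_def by auto
    let ?W = "{v \<in> carrier_vec ?n. Q *\<^sub>v v = a \<cdot>\<^sub>v v}"
    have W: "?W \<noteq> {0\<^sub>v ?n}" using v by blast
    have inv: "\<rho> g *\<^sub>v v \<in> ?W" if "g \<in> carrier G" "v \<in> ?W" for g v
      by (rule eigenspace_invariant[OF Q rD(2)[OF that(1)] comm[OF that(1)] that(2)])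
    from irrep_in_invariant_subspace[OF r is_subspace_eigenspace[OF Q] W inv]
    obtain m \<sigma> T where s: "is_irrep G m \<sigma>" and emb: "rep_embedding G ?n \<rho> m \<sigma> T"
      and TW: "\<And>x. x \<in> carrier_vec m \<Longrightarrow> T *\<^sub>v x \<in> ?W"
      by blast
    obtain L where T: "T \<in> carrier_mat ?n m" and L: "L \<in> carrier_mat m ?n" "L * T = 1\<^sub>m m"
      and tw: "\<And>g. g \<in> carrier G \<Longrightarrow> \<rho> g * T = T * \<sigma> g"
      using emb by (auto simp: rep_embedding_def)
    note ss = is_irrepD(1)[OF s]
    have QT: "Q * T = a \<cdot>\<^sub>m T"
    proof (rule mat_eq_mult_vecI)
      fix x :: "complex vec" assume x: "x \<in> carrier_vec m"
      have "(a \<cdot>\<^sub>m T) *\<^sub>v x = a \<cdot>\<^sub>v (T *\<^sub>v x)" using T x by (intro eq_vecI) auto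
      then show "(Q * T) *\<^sub>v x = (a \<cdot>\<^sub>m T) *\<^sub>v x" using TW[OF x] assoc_mult_mat_vec[OF Q T x] by simp
    qed (use Q T in auto)
    have zero: "mat_sum m m (carrier G) (\<lambda>g. f g \<cdot>\<^sub>m \<sigma> (inv g)) = 0\<^sub>m m m"
    proof (rule class_sum_irrep_eq_0[OF s f])
      let ?\<chi> = "\<lambda>g. if g \<in> carrier G then mat_trace (\<sigma> g) else 0"
      have "?\<chi> \<in> Irr G" using s by (auto simp: Irr_def)
      from o[OF this] show "(\<Sum>g\<in>carrier G. f g * mat_trace (\<sigma> (inv g))) = 0"
        using trace_rep_inv[OF ss] by simp
    qed
    define N where "N = mat_sum m m (carrier G) (\<lambda>g. f' g \<cdot>\<^sub>m \<sigma> (inv g))"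
    have N: "N \<in> carrier_mat m m" by (simp add: N_def)
    have MT: "M * T = T * 0\<^sub>m m m" using class_sum_intertwine[OF r ss T tw, of f] unfolding M_def zero .
    have "M' * T = T * N" unfolding M'_def N_def by (rule class_sum_intertwine[OF r ss T tw])
    \<comment> \<open>\<open>M'\<close> is carried past \<open>T\<close> first, so that
      \<open>M\<close> meets \<open>T\<close> directly and contributes a zero factor. On the other
      hand \<open>T\<close> maps into the eigenspace for \<open>a\<close>, so \<open>a\<close> times
      \<open>T\<close> is zero, and \<open>L\<close> cancels \<open>T\<close>.\<close>
    then have "Q * T = (M * T) * N"
      using assoc_mult_mat[OF MC T] assoc_mult_mat[OF MC(1) T N] by (simp add: Q_def)
    then have "a \<cdot>\<^sub>m T = 0\<^sub>m ?n m" unfolding QT MT using T N by simp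
    then have "a \<cdot>\<^sub>m (L * T) = 0\<^sub>m m m" using mult_smult_distrib[OF L(1) T, of a] L(1) by simp
    \<comment> \<open>The entry (0,0) exists because \<open>m > 0\<close>.\<close>
    then have "(a \<cdot>\<^sub>m 1\<^sub>m m) $$ (0,0) = (0\<^sub>m m m :: complex mat) $$ (0,0)" using L by simp
    then show False using a is_repD(1)[OF ss] by simp
  qed
  then have "(\<Sum>g\<in>carrier G. f g * cnj (f g)) = 0" using trQ order_pos by simp
  then have "complex_of_real (\<Sum>g\<in>carrier G. (cmod (f g))^2) = 0" by (simp add: complex_norm_square del: of_real_power)
  then have "(\<Sum>g\<in>carrier G. (cmod (f g))^2) = 0" by (simp only: of_real_eq_0_iff)
  then have "(cmod (f g))^2 = 0" using g fin by (subst (asm) sum_nonneg_eq_0_iff) auto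
  then show ?thesis by simp
qed

section \<open>Finiteness of the set of characters and column orthogonality\<close>

text \<open>Bessel's inequality for the regular character \<open>b\<close>, whose coefficient at
  \<open>\<chi>\<close> is the degree of \<open>\<chi>\<close>. It is stated for finite
  \<open>F\<close> because finiteness of \<open>Irr G\<close> is deduced from it; equality comes
  later from column orthogonality.\<close>

lemma sum_char_deg_sq_le:
  assumes F: "finite F" "F \<subseteq> Irr G"
  shows "(\<Sum>\<chi>\<in>F. (char_deg G \<chi>)^2) \<le> real (card (carrier G))"
proof -
  let ?n = "of_nat (card (carrier G)) :: complex"
  let ?D = "\<Sum>\<chi>\<in>F. (char_deg G \<chi>)^2"
  define s where "s g = (\<Sum>\<chi>\<in>F. of_real (char_deg G \<chi>) * \<chi> g)" for g
  define b where "b g = (if g = \<one> then ?n else 0)" for g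
  have one: "s \<one> = of_real ?D"
    unfolding s_def using F Irr_one by (auto simp: power2_eq_square intro!: sum.cong)
  have "(\<Sum>g\<in>carrier G. s g * cnj (s g)) =
      (\<Sum>g\<in>carrier G. \<Sum>\<chi>\<in>F. \<Sum>\<psi>\<in>F. of_real (char_deg G \<chi> * char_deg G \<psi>) * (\<chi> g * cnj (\<psi> g)))"
    by (simp add: s_def sum_product algebra_simps)
  also have "\<dots> = (\<Sum>\<chi>\<in>F. \<Sum>g\<in>carrier G. \<Sum>\<psi>\<in>F. of_real (char_deg G \<chi> * char_deg G \<psi>) * (\<chi> g * cnj (\<psi> g)))"
    by (rule sum.swap)
  also have "\<dots> = (\<Sum>\<chi>\<in>F. \<Sum>\<psi>\<in>F. of_real (char_deg G \<chi> * char_deg G \<psi>) * (\<Sum>g\<in>carrier G. \<chi> g * cnj (\<psi> g)))"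
    unfolding sum_distrib_left by (intro sum.cong refl sum.swap)
  also have "\<dots> = (\<Sum>\<chi>\<in>F. \<Sum>\<psi>\<in>F. if \<chi> = \<psi> then of_real ((char_deg G \<chi>)^2) * ?n else 0)"
    using F Irr_orthogonal by (intro sum.cong refl) (auto simp: power2_eq_square subset_iff)
  also have "\<dots> = of_real ?D * ?n" using F by (simp add: sum_distrib_right)
  finally have ss: "(\<Sum>g\<in>carrier G. s g * cnj (s g)) = of_real ?D * ?n" .
  \<comment> \<open>\<open>b\<close> vanishes off the identity and \<open>s\<close> takes the real
    value \<open>?D\<close> there, so the cross terms occur at a single point.\<close>
  have eq: "(b g - s g) * cnj (b g - s g) = (if g = \<one> then ?n * ?n - 2 * ?n * of_real ?D else 0) + s g * cnj (s g)" for g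
    using one by (auto simp: b_def algebra_simps)
  have "complex_of_real (\<Sum>g\<in>carrier G. (cmod (b g - s g))^2) = (\<Sum>g\<in>carrier G. (b g - s g) * cnj (b g - s g))"
    by (simp add: complex_norm_square del: of_real_power)
  also have "\<dots> = ?n * ?n - 2 * ?n * of_real ?D + of_real ?D * ?n"
    unfolding eq sum.distrib ss using fin by simp
  also have "\<dots> = of_real (real (card (carrier G)) * (real (card (carrier G)) - ?D))"
    by (simp add: algebra_simps)
  finally have "(\<Sum>g\<in>carrier G. (cmod (b g - s g))^2) = real (card (carrier G)) * (real (card (carrier G)) - ?D)"
    by (simp only: of_real_eq_iff)
  moreover have "(\<Sum>g\<in>carrier G. (cmod (b g - s g))^2) \<ge> 0" by (intro sum_nonneg) auto
  ultimately show ?thesis using order_pos by (simp add: zero_le_mult_iff)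
qed

lemma finite_Irr: "finite (Irr G)"
proof (rule finite_if_finite_subsets_card_bdd[THEN conjunct1])
  show "card F \<le> card (carrier G)" if "F \<subseteq> Irr G" "finite F" for F
  proof -
    have "real (card F) = (\<Sum>\<chi>\<in>F. 1)" by simp
    also have "\<dots> \<le> (\<Sum>\<chi>\<in>F. (char_deg G \<chi>)^2)"
      by (intro sum_mono) (use char_deg_ge_1 that in \<open>force intro: one_le_power\<close>)
    finally show ?thesis using sum_char_deg_sq_le[OF that(2,1)] by linarith
  qed
qed

text \<open>For fixed \<open>h\<close> the count \<open>c\<close> is a class function of
  \<open>g\<close> whose inner product with \<open>\<psi>\<close> is |G| times the conjugate of
  \<open>\<psi> h\<close>. The left side is therefore its expansion in characters, and completeness
  makes the difference \<open>f\<close> vanish.\<close>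

lemma Irr_column_orthogonal:
  assumes g: "g \<in> carrier G" and h: "h \<in> carrier G"
  shows "(\<Sum>\<chi>\<in>Irr G. \<chi> g * cnj (\<chi> h)) = of_nat (card {x \<in> carrier G. g \<otimes> x = x \<otimes> h})"
proof -
  let ?n = "of_nat (card (carrier G)) :: complex"
  define c where "c g = card {x \<in> carrier G. g \<otimes> x = x \<otimes> h}" for g
  define f where "f g = of_nat (c g) - (\<Sum>\<chi>\<in>Irr G. \<chi> g * cnj (\<chi> h))" for g
  have "f g = 0"
  proof (rule class_function_eq_0[OF _ _ g])
    fix g y assume g: "g \<in> carrier G" and y: "y \<in> carrier G"
    have "{x \<in> carrier G. y \<otimes> g \<otimes> inv y \<otimes> x = x \<otimes> h} = (\<lambda>x. y \<otimes> x) ` {x \<in> carrier G. g \<otimes> x = x \<otimes> h}"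
    proof (intro equalityI subsetI)
      fix x assume "x \<in> {x \<in> carrier G. y \<otimes> g \<otimes> inv y \<otimes> x = x \<otimes> h}"
      then have x: "x \<in> carrier G" "y \<otimes> g \<otimes> inv y \<otimes> x = x \<otimes> h" by auto
      then have "inv y \<otimes> (y \<otimes> (g \<otimes> (inv y \<otimes> x))) = inv y \<otimes> (x \<otimes> h)" using g y by (simp add: m_assoc)
      then have "g \<otimes> (inv y \<otimes> x) = inv y \<otimes> x \<otimes> h" using g y h x(1) by (simp add: m_assoc)
      then show "x \<in> (\<lambda>x. y \<otimes> x) ` {x \<in> carrier G. g \<otimes> x = x \<otimes> h}"
        using x y by (intro image_eqI[of _ _ "inv y \<otimes> x"]) auto
    next
      fix x assume "x \<in> (\<lambda>x. y \<otimes> x) ` {x \<in> carrier G. g \<otimes> x = x \<otimes> h}"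
      then show "x \<in> {x \<in> carrier G. y \<otimes> g \<otimes> inv y \<otimes> x = x \<otimes> h}" using g y h by (auto simp: m_assoc)
    qed
    moreover have "inj_on (\<lambda>x. y \<otimes> x) {x \<in> carrier G. g \<otimes> x = x \<otimes> h}"
      using y by (auto simp: inj_on_def)
    ultimately have "c (y \<otimes> g \<otimes> inv y) = c g" unfolding c_def by (simp add: card_image)
    moreover have "(\<Sum>\<chi>\<in>Irr G. \<chi> (y \<otimes> g \<otimes> inv y) * cnj (\<chi> h)) = (\<Sum>\<chi>\<in>Irr G. \<chi> g * cnj (\<chi> h))"
      by (intro sum.cong refl arg_cong2[of _ _ _ _ "(*)"] Irr_conj[OF _ g y])
    ultimately show "f (y \<otimes> g \<otimes> inv y) = f g" by (simp add: f_def)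
  next
    fix \<psi> assume \<psi>: "\<psi> \<in> Irr G"
    have "(\<Sum>g\<in>carrier G. of_nat (c g) * cnj (\<psi> g)) =
        (\<Sum>g\<in>carrier G. \<Sum>x\<in>carrier G. (if g \<otimes> x = x \<otimes> h then cnj (\<psi> g) else 0))"
      using fin by (intro sum.cong refl) (simp add: c_def sum.If_cases Int_def)
    also have "\<dots> = (\<Sum>x\<in>carrier G. \<Sum>g\<in>carrier G. (if g \<otimes> x = x \<otimes> h then cnj (\<psi> g) else 0))"
      by (rule sum.swap)
    \<comment> \<open>For fixed \<open>x\<close> the equation has exactly one solution
      \<open>g\<close>, a conjugate of \<open>h\<close>.\<close>
    also have "\<dots> = (\<Sum>x\<in>carrier G. \<Sum>g\<in>carrier G. (if g = x \<otimes> h \<otimes> inv x then cnj (\<psi> g) else 0))"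
      using h by (intro sum.cong refl if_cong) (subst inv_solve_right, auto)
    also have "\<dots> = (\<Sum>x\<in>carrier G. cnj (\<psi> h))"
      using fin h Irr_conj[OF \<psi> h] by (intro sum.cong refl) simp
    finally have 1: "(\<Sum>g\<in>carrier G. of_nat (c g) * cnj (\<psi> g)) = ?n * cnj (\<psi> h)" by simp
    have "(\<Sum>g\<in>carrier G. (\<Sum>\<chi>\<in>Irr G. \<chi> g * cnj (\<chi> h)) * cnj (\<psi> g)) =
        (\<Sum>g\<in>carrier G. \<Sum>\<chi>\<in>Irr G. cnj (\<chi> h) * (\<chi> g * cnj (\<psi> g)))"
      by (simp add: sum_distrib_left sum_distrib_right algebra_simps)
    also have "\<dots> = (\<Sum>\<chi>\<in>Irr G. cnj (\<chi> h) * (\<Sum>g\<in>carrier G. \<chi> g * cnj (\<psi> g)))"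
      unfolding sum_distrib_left by (rule sum.swap)
    also have "\<dots> = (\<Sum>\<chi>\<in>Irr G. if \<chi> = \<psi> then cnj (\<psi> h) * ?n else 0)"
      using Irr_orthogonal[OF _ \<psi>] by (intro sum.cong refl) auto
    also have "\<dots> = ?n * cnj (\<psi> h)" using finite_Irr \<psi> by simp
    finally show "(\<Sum>g\<in>carrier G. f g * cnj (\<psi> g)) = 0"
      using 1 by (simp add: f_def left_diff_distrib sum_subtractf)
  qed
  then show ?thesis by (simp add: f_def c_def)
qed

section \<open>Bounds for the distance in terms of centralizers\<close>

definition centralizer :: "'a \<Rightarrow> 'a set" where
  "centralizer h = {x \<in> carrier G. h \<otimes> x = x \<otimes> h}"

lemma sum_char_norm_sq:
  assumes "h \<in> carrier G"
  shows "(\<Sum>\<chi>\<in>Irr G. (cmod (\<chi> h))^2) = real (card (centralizer h))"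
proof -
  have "complex_of_real (\<Sum>\<chi>\<in>Irr G. (cmod (\<chi> h))^2) = of_real (real (card (centralizer h)))"
    using Irr_column_orthogonal[OF assms assms] by (simp add: complex_norm_square centralizer_def del: of_real_power)
  then show ?thesis by (simp only: of_real_eq_iff)
qed

lemma sum_char_deg_sq: "(\<Sum>\<chi>\<in>Irr G. (char_deg G \<chi>)^2) = real (card (carrier G))"
proof -
  have "centralizer \<one> = carrier G" by (auto simp: centralizer_def)
  moreover have "(\<Sum>\<chi>\<in>Irr G. (char_deg G \<chi>)^2) = (\<Sum>\<chi>\<in>Irr G. (cmod (\<chi> \<one>))^2)"
    by (intro sum.cong refl) (subst Irr_one, simp_all)
  ultimately show ?thesis using sum_char_norm_sq[OF one_closed] by simp
qed

lemma D_dist_le: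
  assumes H: "H \<subseteq> carrier G"
  shows "D_dist G H \<le> (\<Sum>h\<in>H - {\<one>}. sqrt (real (card (centralizer h)) / real (card (carrier G))))"
proof -
  let ?n = "real (card (carrier G))"
  have n: "?n > 0" using order_pos by simp
  have "(\<Sum>\<chi>\<in>Irr G. char_deg G \<chi> * cmod (\<Sum>h\<in>H - {\<one>}. \<chi> h)) \<le>
      (\<Sum>\<chi>\<in>Irr G. \<Sum>h\<in>H - {\<one>}. char_deg G \<chi> * cmod (\<chi> h))"
    unfolding sum_distrib_left[symmetric]
    by (intro sum_mono mult_left_mono norm_sum) (use char_deg_ge_1 in force)
  also have "\<dots> = (\<Sum>h\<in>H - {\<one>}. \<Sum>\<chi>\<in>Irr G. char_deg G \<chi> * cmod (\<chi> h))" by (rule sum.swap)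
  also have "\<dots> \<le> (\<Sum>h\<in>H - {\<one>}. sqrt (?n * real (card (centralizer h))))"
  proof (rule sum_mono)
    fix h assume "h \<in> H - {\<one>}"
    then have h: "h \<in> carrier G" using H by auto
    have "(\<Sum>\<chi>\<in>Irr G. char_deg G \<chi> * cmod (\<chi> h)) \<le> (\<Sum>\<chi>\<in>Irr G. \<bar>char_deg G \<chi>\<bar> * \<bar>cmod (\<chi> h)\<bar>)"
      by (intro sum_mono) (auto intro!: mult_right_mono)
    also have "\<dots> \<le> L2_set (char_deg G) (Irr G) * L2_set (\<lambda>\<chi>. cmod (\<chi> h)) (Irr G)"
      by (rule L2_set_mult_ineq)
    finally show "(\<Sum>\<chi>\<in>Irr G. char_deg G \<chi> * cmod (\<chi> h)) \<le> sqrt (?n * real (card (centralizer h)))"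
      unfolding L2_set_def sum_char_deg_sq sum_char_norm_sq[OF h] by (simp add: real_sqrt_mult)
  qed
  finally have "D_dist G H \<le> (1 / ?n) * (\<Sum>h\<in>H - {\<one>}. sqrt (?n * real (card (centralizer h))))"
    unfolding D_dist_def by (intro mult_left_mono) auto
  also have "\<dots> = (\<Sum>h\<in>H - {\<one>}. sqrt (real (card (centralizer h)) / ?n))"
    unfolding sum_distrib_left
    by (intro sum.cong refl) (use n in \<open>simp add: real_sqrt_mult real_sqrt_divide field_simps\<close>)
  finally show ?thesis .
qed

text \<open>There is no cancellation between elements of \<open>H\<close>: by column orthogonality
  the second moment of the inner character sums is a double sum of nonnegative counts, so the term
  \<open>x = y = h\<close> bounds it from below.\<close>

lemma D_dist_ge:
  assumes H: "H \<subseteq> carrier G" and h: "h \<in> H" "h \<noteq> \<one>"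
  shows "real (card (centralizer h)) / (real (card (carrier G)) * real (card H)) \<le> D_dist G H"
proof -
  let ?n = "real (card (carrier G))"
  let ?S = "H - {\<one>}"
  have n: "?n > 0" using order_pos by simp
  have fH: "finite H" using H fin finite_subset by blast
  then have cH: "card H > 0" using h by (auto simp: card_gt_0_iff)
  have S: "x \<in> carrier G" if "x \<in> ?S" for x using that H by auto
  let ?c = "\<lambda>x y. card {z \<in> carrier G. x \<otimes> z = z \<otimes> y}"
  have "complex_of_real (\<Sum>\<chi>\<in>Irr G. (cmod (\<Sum>h\<in>?S. \<chi> h))^2) =
      (\<Sum>\<chi>\<in>Irr G. \<Sum>x\<in>?S. \<Sum>y\<in>?S. \<chi> x * cnj (\<chi> y))"
    by (simp add: complex_norm_square sum_product del: of_real_power)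
  also have "\<dots> = (\<Sum>x\<in>?S. \<Sum>\<chi>\<in>Irr G. \<Sum>y\<in>?S. \<chi> x * cnj (\<chi> y))" by (rule sum.swap)
  also have "\<dots> = (\<Sum>x\<in>?S. \<Sum>y\<in>?S. \<Sum>\<chi>\<in>Irr G. \<chi> x * cnj (\<chi> y))" by (intro sum.cong refl sum.swap)
  also have "\<dots> = (\<Sum>x\<in>?S. \<Sum>y\<in>?S. of_nat (?c x y))"
    by (intro sum.cong refl Irr_column_orthogonal S)
  also have "\<dots> = complex_of_real (real (\<Sum>x\<in>?S. \<Sum>y\<in>?S. ?c x y))" by simp
  finally have eq: "(\<Sum>\<chi>\<in>Irr G. (cmod (\<Sum>h\<in>?S. \<chi> h))^2) = real (\<Sum>x\<in>?S. \<Sum>y\<in>?S. ?c x y)"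
    by (simp only: of_real_eq_iff)
  have "card (centralizer h) \<le> (\<Sum>y\<in>?S. ?c h y)"
    using member_le_sum[of h ?S "\<lambda>y. ?c h y"] h fH by (simp add: centralizer_def)
  also have "\<dots> \<le> (\<Sum>x\<in>?S. \<Sum>y\<in>?S. ?c x y)"
    using member_le_sum[of h ?S "\<lambda>x. \<Sum>y\<in>?S. ?c x y"] h fH by simp
  finally have "real (card (centralizer h)) \<le> (\<Sum>\<chi>\<in>Irr G. (cmod (\<Sum>h\<in>?S. \<chi> h))^2)"
    unfolding eq by (simp only: of_nat_le_iff)
  also have "\<dots> \<le> (\<Sum>\<chi>\<in>Irr G. real (card H) * (char_deg G \<chi> * cmod (\<Sum>h\<in>?S. \<chi> h)))"
  proof (rule sum_mono)
    fix \<chi> assume \<chi>: "\<chi> \<in> Irr G"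
    \<comment> \<open>Only one of the two factors of the square is estimated; the other one remains
      to form \<open>D_dist\<close>.\<close>
    have "cmod (\<Sum>h\<in>?S. \<chi> h) \<le> (\<Sum>h\<in>?S. char_deg G \<chi>)"
      by (rule order_trans[OF norm_sum sum_mono]) (use Irr_norm_le[OF \<chi>] S in auto)
    also have "\<dots> \<le> real (card H) * char_deg G \<chi>"
      using char_deg_ge_1[OF \<chi>] card_mono[OF fH, of ?S] by (auto intro!: mult_right_mono)
    finally show "(cmod (\<Sum>h\<in>?S. \<chi> h))^2 \<le> real (card H) * (char_deg G \<chi> * cmod (\<Sum>h\<in>?S. \<chi> h))"
      unfolding power2_eq_square mult.assoc[symmetric] by (rule mult_right_mono) simp
  qed
  also have "\<dots> = real (card H) * (?n * D_dist G H)"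
    using n by (simp add: D_dist_def sum_distrib_left)
  finally show ?thesis using n cH by (simp add: field_simps)
qed

end

section \<open>Centralizers in symmetric groups\<close>

lemma fin_group_sym_group: "fin_group (sym_group n)"
  by (intro fin_group.intro sym_group_is_group fin_group_axioms.intro)
     (simp add: sym_group_def finite_permutations)

lemma card_sym_group: "card (carrier (sym_group n)) = fact n"
  by (simp add: sym_group_def card_permutations)

lemma centralizer_sym_group:
  "fin_group.centralizer (sym_group n) h = {x. x permutes {1..n} \<and> h \<circ> x = x \<circ> h}"
  unfolding fin_group.centralizer_def[OF fin_group_sym_group] by (simp add: sym_group_def)

lemma moved_points_subset:
  assumes "h permutes S"
  shows "{x. h x \<noteq> x} \<subseteq> S"
  using assms by (auto simp: permutes_def)

text \<open>A permutation that moves only fixed points of \<open>h\<close> has support disjoint from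
  that of \<open>h\<close>, hence commutes with it.\<close>

lemma card_centralizer_ge:
  assumes h: "h permutes {1..n}"
  shows "fact (n - supp h) \<le> card {x. x permutes {1..n} \<and> h \<circ> x = x \<circ> h}"
proof -
  let ?M = "{x. h x \<noteq> x}"
  have M: "?M \<subseteq> {1..n}" using moved_points_subset[OF h] .
  then have "finite ?M" using finite_subset by blast
  then have "card ({1..n} - ?M) = n - supp h" using M by (simp add: card_Diff_subset supp_def)
  then have "fact (n - supp h) = card {x. x permutes ({1..n} - ?M)}"
    by (simp add: card_permutations)
  also have "\<dots> \<le> card {x. x permutes {1..n} \<and> h \<circ> x = x \<circ> h}"
  proof (rule card_mono)
    show "finite {x. x permutes {1..n} \<and> h \<circ> x = x \<circ> h}"
      by (rule finite_subset[OF _ finite_permutations[of "{1..n}"]]) auto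
    have "h (x y) = x (h y)" if x: "x permutes ({1..n} - ?M)" for x y
    proof (cases "h y = y")
      case True
      have "h (x y) = x y"
      proof (rule ccontr)
        assume "h (x y) \<noteq> x y"
        then have "x (x y) = x y" using permutes_not_in[OF x, of "x y"] by simp
        then have "x y = y" using permutes_inj[OF x] by (simp add: inj_eq)
        then show False using \<open>h (x y) \<noteq> x y\<close> True by simp
      qed
      then show ?thesis using True by simp
    next
      case False
      then have "h (h y) \<noteq> h y" using permutes_inj[OF h] by (simp add: inj_eq)
      then show ?thesis using False permutes_not_in[OF x, of y] permutes_not_in[OF x, of "h y"] by simp
    qed
    then show "{x. x permutes ({1..n} - ?M)} \<subseteq> {x. x permutes {1..n} \<and> h \<circ> x = x \<circ> h}"
      using permutes_subset[of _ "{1..n} - ?M" "{1..n}"] by auto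
  qed
  finally show ?thesis .
qed

lemma fact_le_fact_diff_mult_power:
  assumes "r \<le> n"
  shows "fact n \<le> fact (n - r) * (n::nat) ^ r"
proof -
  have "fact (n - r) dvd (fact n :: nat)" by (rule fact_dvd) simp
  then have "fact n = fact (n - r) * (fact n div fact (n - r) :: nat)" by simp
  also have "\<dots> \<le> fact (n - r) * n ^ r" using fact_div_fact_le_pow[OF assms] by simp
  finally show ?thesis .
qed

text \<open>Greedy choice: picking \<open>a\<close> excludes at most the three points \<open>a\<close>, \<open>h a\<close> and \<open>h\<^sup>-\<^sup>1 a\<close>.\<close>

lemma disjoint_image_subset_exists:
  assumes h: "h permutes S" and S: "finite S" and k: "3 * k \<le> supp h"
  shows "\<exists>A\<subseteq>S. card A = k \<and> A \<inter> h ` A = {}"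
  using k
proof (induction k)
  case (Suc k)
  then obtain A where A: "A \<subseteq> S" "card A = k" "A \<inter> h ` A = {}" by auto
  have fA: "finite A" using A S finite_subset by blast
  let ?E = "A \<union> h ` A \<union> h -` A"
  have inj: "inj h" using h by (rule permutes_inj)
  have fE: "finite ?E" using fA finite_vimageI[OF fA inj] by simp
  have "card ?E \<le> card A + card (h ` A) + card (h -` A)"
    by (meson add_le_mono card_Un_le order_refl order_trans)
  also have "\<dots> \<le> 3 * k" using card_image_le[OF fA, of h] card_vimage_inj_on_le[OF inj fA] A(2) by simp
  also have "\<dots> < card {x. h x \<noteq> x}" using Suc.prems by (simp add: supp_def)
  finally have "\<not> {x. h x \<noteq> x} \<subseteq> ?E" using card_mono[OF fE] by (meson leD)
  then obtain a where a: "h a \<noteq> a" "a \<notin> A" "a \<notin> h ` A" "h a \<notin> A" by blast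
  have "insert a A \<inter> h ` insert a A = {}" using A(3) a by auto
  moreover have "insert a A \<subseteq> S" using A(1) a(1) moved_points_subset[OF h] by auto
  moreover have "card (insert a A) = Suc k" using fA a(2) A(2) by simp
  ultimately show ?case by blast
qed auto

lemma ex_permutes_extending_inj_on:
  assumes S: "finite S" and A: "A \<subseteq> S" and f: "inj_on f A" "f ` A \<subseteq> S"
  shows "\<exists>p. p permutes S \<and> (\<forall>a\<in>A. p a = f a)"
proof -
  have "card (S - A) = card (S - f ` A)"
    using S A f by (simp add: card_Diff_subset finite_subset card_image)
  then obtain g where g: "bij_betw g (S - A) (S - f ` A)"
    using finite_same_card_bij[of "S - A" "S - f ` A"] S by auto
  define p where "p x = (if x \<in> A then f x else if x \<in> S then g x else x)" for x
  have "bij_betw p A (f ` A)" using f(1) by (simp add: p_def bij_betw_def inj_on_def)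
  moreover have "bij_betw p (S - A) (S - f ` A)"
    using g by (rule bij_betw_cong[THEN iffD1, rotated]) (simp add: p_def)
  ultimately have "bij_betw p (A \<union> (S - A)) (f ` A \<union> (S - f ` A))"
    by (rule bij_betw_combine) auto
  then have "bij_betw p S S" using A f(2) by (simp add: Un_absorb1)
  then have "p permutes S" using A by (intro bij_imp_permutes) (auto simp: p_def)
  then show ?thesis by (intro exI[of _ p]) (simp add: p_def)
qed

text \<open>The number of such lists is a falling factorial with \<open>k\<close> factors, each
  greater than \<open>m\<close>.\<close>

lemma power_le_card_distinct_lists:
  assumes "finite B" "card B \<ge> m + k"
  shows "m ^ k \<le> card {xs. length xs = k \<and> distinct xs \<and> set xs \<subseteq> B}"
proof -
  have "m ^ k = (\<Prod>i\<in>{card B - k + 1..card B}. m)" using assms(2) by simp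
  also have "\<dots> \<le> \<Prod>{card B - k + 1..card B}"
    by (rule prod_mono) (use assms in auto)
  finally show ?thesis using card_lists_distinct_length_eq[of B k] assms by simp
qed

text \<open>The \<open>k\<close>-tuples \<open>b\<close> of distinct points outside \<open>A\<close> give distinct conjugates of \<open>h\<close>, namely
  ones that map the elements of \<open>A\<close> to the entries of \<open>b\<close>; hence distinct cosets of the centralizer.\<close>

lemma card_centralizer_le:
  assumes h: "h permutes {1..n}" and k: "3 * k \<le> supp h" and n: "m + 2 * k \<le> n"
  shows "m ^ k * card {x. x permutes {1..n} \<and> h \<circ> x = x \<circ> h} \<le> fact n"
proof -
  let ?S = "{1..n}"
  let ?C = "{x. x permutes ?S \<and> h \<circ> x = x \<circ> h}"
  \<comment> \<open>Since \<open>A\<close> and its image under \<open>h\<close> are disjoint, a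
    permutation \<open>x\<close> may be prescribed on both independently. If \<open>x\<close> fixes
    \<open>A\<close> pointwise and sends each \<open>h (as ! i)\<close> to \<open>xs ! i\<close>,
    the conjugate of \<open>h\<close> by \<open>x\<close> maps \<open>as ! i\<close> to
    \<open>xs ! i\<close>.\<close>
  obtain A where A: "A \<subseteq> ?S" "card A = k" "A \<inter> h ` A = {}"
    using disjoint_image_subset_exists[OF h _ k] by auto
  have fA: "finite A" using A(1) finite_subset by blast
  obtain as where as: "set as = A" "distinct as" using finite_distinct_list[OF fA] by blast
  have las: "length as = k" using as A(2) distinct_card by fastforce
  define T where "T = {xs. length xs = k \<and> distinct xs \<and> set xs \<subseteq> ?S - A}"
  \<comment> \<open>The \<open>2 * k\<close> in the hypothesis pays \<open>k\<close> points for
    \<open>A\<close> and \<open>k\<close> for the distinctness of the entries.\<close>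
  have "card (?S - A) \<ge> m + k" using A n fA by (simp add: card_Diff_subset)
  then have cardT: "m ^ k \<le> card T"
    unfolding T_def by (rule power_le_card_distinct_lists[rotated]) simp
  have "\<forall>xs\<in>T. \<exists>x. x permutes ?S \<and> (\<forall>i<k. x (as ! i) = as ! i \<and> x (h (as ! i)) = xs ! i)"
  proof
    fix xs assume "xs \<in> T"
    then have xs: "length xs = k" "distinct xs" "set xs \<subseteq> ?S - A" by (auto simp: T_def)
    \<comment> \<open>The definite description inverts the injective map from an index
      \<open>i\<close> to \<open>h (as ! i)\<close>.\<close>
    define f where "f y = (if y \<in> A then y else xs ! (THE i. i < k \<and> h (as ! i) = y))" for y
    have inj_as: "i < k \<Longrightarrow> j < k \<Longrightarrow> h (as ! i) = h (as ! j) \<longleftrightarrow> i = j" for i j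
      using permutes_inj[OF h] as(2) las by (auto simp: inj_eq nth_eq_iff_index_eq)
    have asA: "i < k \<Longrightarrow> as ! i \<in> A" for i using as(1) las nth_mem by blast
    have hA: "y \<in> h ` A \<longleftrightarrow> (\<exists>i<k. y = h (as ! i))" for y
      unfolding as(1)[symmetric] las[symmetric] set_conv_nth by blast
    have fh: "f (h (as ! i)) = xs ! i" if "i < k" for i
    proof -
      have "(THE j. j < k \<and> h (as ! j) = h (as ! i)) = i" using inj_as that by blast
      moreover have "h (as ! i) \<notin> A" using A(3) asA[OF that] by blast
      ultimately show ?thesis by (simp add: f_def)
    qed
    have xsn: "i < k \<Longrightarrow> xs ! i \<in> ?S - A" for i using xs nth_mem by blast
    \<comment> \<open>The entries of \<open>xs\<close> are distinct and avoid \<open>A\<close>, so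
      they clash neither with each other nor with the fixed points in \<open>A\<close>.\<close>
    have "inj_on f (A \<union> h ` A)"
    proof (rule inj_onI)
      fix y z assume yz: "y \<in> A \<union> h ` A" "z \<in> A \<union> h ` A" "f y = f z"
      show "y = z"
      proof (cases "y \<in> A"; cases "z \<in> A")
        assume "y \<in> A" "z \<in> A"
        then show ?thesis using yz by (simp add: f_def)
      next
        assume y: "y \<in> A" and z: "z \<notin> A"
        then obtain j where "j < k" "z = h (as ! j)" using yz hA by blast
        then show ?thesis using fh[of j] xsn[of j] yz(3) y by (simp add: f_def)
      next
        assume y: "y \<notin> A" and z: "z \<in> A"
        then obtain j where "j < k" "y = h (as ! j)" using yz hA by blast
        then show ?thesis using fh[of j] xsn[of j] yz(3) z by (simp add: f_def)
      next
        assume y: "y \<notin> A" and z: "z \<notin> A"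
        obtain i j where ij: "i < k" "y = h (as ! i)" "j < k" "z = h (as ! j)" using y z yz hA by blast
        then have "xs ! i = xs ! j" using fh yz(3) by simp
        then show ?thesis using xs ij by (simp add: nth_eq_iff_index_eq)
      qed
    qed
    moreover have "f ` (A \<union> h ` A) \<subseteq> ?S"
    proof
      fix z assume "z \<in> f ` (A \<union> h ` A)"
      then obtain y where y: "y \<in> A \<union> h ` A" "z = f y" by blast
      show "z \<in> ?S"
      proof (cases "y \<in> A")
        case True
        then show ?thesis using A(1) y(2) by (auto simp: f_def)
      next
        case False
        then obtain i where "i < k" "y = h (as ! i)" using y(1) hA by blast
        then show ?thesis using fh[of i] xsn[of i] y(2) by simp
      qed
    qed
    moreover have "A \<union> h ` A \<subseteq> ?S" using A(1) permutes_image[OF h] by blast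
    ultimately have "\<exists>x. x permutes ?S \<and> (\<forall>a\<in>A \<union> h ` A. x a = f a)"
      by (intro ex_permutes_extending_inj_on) simp_all
    then obtain x where x: "x permutes ?S" "\<And>a. a \<in> A \<union> h ` A \<Longrightarrow> x a = f a" by blast
    have "x (as ! i) = as ! i \<and> x (h (as ! i)) = xs ! i" if "i < k" for i
      using x(2)[of "as ! i"] x(2)[of "h (as ! i)"] asA[OF that] fh[OF that] by (simp add: f_def)
    then show "\<exists>x. x permutes ?S \<and> (\<forall>i<k. x (as ! i) = as ! i \<and> x (h (as ! i)) = xs ! i)"
      using x(1) by blast
  qed
  from bchoice[OF this] obtain X where X: "\<And>xs. xs \<in> T \<Longrightarrow> X xs permutes ?S"
    "\<And>xs i. xs \<in> T \<Longrightarrow> i < k \<Longrightarrow> X xs (as ! i) = as ! i"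
    "\<And>xs i. xs \<in> T \<Longrightarrow> i < k \<Longrightarrow> X xs (h (as ! i)) = xs ! i"
    by blast
  \<comment> \<open>Injectivity says that distinct tuples select distinct left cosets of the
    centralizer \<open>?C\<close>.\<close>
  have "inj_on (\<lambda>(xs, z). X xs \<circ> z) (T \<times> ?C)"
  proof (rule inj_onI, clarify)
    fix xs z ys w
    assume xsT: "xs \<in> T" and ysT: "ys \<in> T"
      and z: "z permutes ?S" "h \<circ> z = z \<circ> h" and w: "w permutes ?S" "h \<circ> w = w \<circ> h"
      and eq: "X xs \<circ> z = X ys \<circ> w"
    have "xs ! i = ys ! i" if i: "i < k" for i
    proof -
      \<comment> \<open>\<open>u\<close> is the preimage of \<open>as ! i\<close> under
        \<open>z\<close>. As \<open>X xs\<close> and \<open>X ys\<close> both fix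
        \<open>as ! i\<close>, it is also the preimage under \<open>w\<close>; comparing the two
        products at \<open>h u\<close> then reveals the entries.\<close>
      obtain u where u: "z u = as ! i" using permutes_surj[OF z(1)] by (metis surjD)
      have "X ys (w u) = X ys (as ! i)"
        using fun_cong[OF eq, of u] u X(2)[OF xsT i] X(2)[OF ysT i] by simp
      then have wu: "w u = as ! i" using permutes_inj[OF X(1)[OF ysT]] by (simp add: inj_eq)
      have "xs ! i = X xs (h (z u))" using X(3)[OF xsT i] u by simp
      also have "\<dots> = X xs (z (h u))" using fun_cong[OF z(2), of u] by simp
      also have "\<dots> = X ys (w (h u))" using fun_cong[OF eq, of "h u"] by simp
      also have "\<dots> = X ys (h (w u))" using fun_cong[OF w(2), of u] by simp
      also have "\<dots> = ys ! i" using X(3)[OF ysT i] wu by simp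
      finally show ?thesis .
    qed
    then have e: "xs = ys" using xsT ysT by (intro nth_equalityI) (auto simp: T_def)
    have "z u = w u" for u
      using fun_cong[OF eq, of u] permutes_inj[OF X(1)[OF ysT]] unfolding e by (simp add: inj_eq)
    then show "xs = ys \<and> z = w" using e by auto
  qed
  moreover have "(\<lambda>(xs, z). X xs \<circ> z) ` (T \<times> ?C) \<subseteq> {x. x permutes ?S}"
    using X(1) permutes_compose by auto
  ultimately have "card (T \<times> ?C) \<le> card {x. x permutes ?S}"
    by (rule card_inj_on_le) (simp add: finite_permutations)
  then have "card T * card ?C \<le> fact n" by (simp add: card_permutations card_cartesian_product)
  moreover have "m ^ k * card ?C \<le> card T * card ?C" using cardT by (rule mult_right_mono) simp
  ultimately show ?thesis by linarith
qed

section \<open>Estimates of the distance in symmetric groups and comparison with ln n!\<close>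

text \<open>For the trivial subgroup the infimum over the empty set is infinity and the right side
  is vacuous, in accordance with the convention.\<close>

lemma le_min_degree_iff: "enat k \<le> min_degree H \<longleftrightarrow> (\<forall>h\<in>H - {id}. k \<le> supp h)"
  by (auto simp: min_degree_def le_INF_iff)

text \<open>The exponent \<open>K\<close> bounds the number n! / |C(h)| of conjugates of
  \<open>h\<close> by n^K, and \<open>c\<close> accounts for the division by |H|.\<close>

lemma D_dist_sym_group_ge:
  assumes H: "subgroup H (sym_group n)" and h: "h \<in> H" "h \<noteq> id" "supp h \<le> K"
    and c: "real (card H) \<le> real n powr c" and n: "n > 0"
  shows "real n powr - (real K + c) \<le> D_dist (sym_group n) H"
proof -
  interpret fin_group "sym_group n" by (rule fin_group_sym_group)
  have Hc: "H \<subseteq> carrier (sym_group n)" using H by (rule subgroup.subset)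
  have hp: "h permutes {1..n}" using Hc h by (auto simp: sym_group_def)
  let ?C = "card (centralizer h)"
  have sn: "supp h \<le> n" using card_mono[OF _ moved_points_subset[OF hp]] by (simp add: supp_def)
  have "fact n \<le> fact (n - supp h) * n ^ supp h" by (rule fact_le_fact_diff_mult_power[OF sn])
  also have "\<dots> \<le> ?C * n ^ K"
    using card_centralizer_ge[OF hp] h(3) n unfolding centralizer_sym_group
    by (intro mult_mono power_increasing) auto
  finally have "real (fact n) \<le> real (?C * n ^ K)" by (simp only: of_nat_le_iff)
  then have C: "real (fact n) \<le> real ?C * real n powr real K" using n by (simp add: powr_realpow)
  have cH: "card H > 0" using h(1) finite_subset[OF Hc fin] by (auto simp: card_gt_0_iff)
  have "real n powr - (real K + c) = 1 / (real n powr real K * real n powr c)"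
    unfolding powr_minus powr_add by (simp add: divide_inverse)
  also have "\<dots> \<le> 1 / (real n powr real K * real (card H))"
    using c n cH by (intro divide_left_mono mult_left_mono mult_pos_pos) auto
  also have "\<dots> \<le> real ?C / (real (fact n) * real (card H))"
    using C n cH by (simp add: field_simps)
  also have "\<dots> \<le> D_dist (sym_group n) H"
    using D_dist_ge[OF Hc h(1)] h(2) by (simp add: card_sym_group sym_group_one)
  finally show ?thesis .
qed

lemma D_dist_sym_group_le:
  assumes H: "subgroup H (sym_group n)" and k: "\<And>h. h \<in> H \<Longrightarrow> h \<noteq> id \<Longrightarrow> 3 * k \<le> supp h"
    and c: "real (card H) \<le> real n powr c" and n: "n \<ge> 4 * k" "n \<ge> 16"
  shows "D_dist (sym_group n) H \<le> real n powr (c - real k / 4)"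
proof -
  interpret fin_group "sym_group n" by (rule fin_group_sym_group)
  have Hc: "H \<subseteq> carrier (sym_group n)" using H by (rule subgroup.subset)
  have fH: "finite H" using finite_subset[OF Hc fin] .
  have n0: "real n > 0" using n by simp
  define m where "m = n div 2"
  have m: "m + 2 * k \<le> n" using n by (simp add: m_def)
  \<comment> \<open>Replacing n div 2 by the square root of \<open>n\<close> turns the bound into a
    pure power of \<open>n\<close>. The lost half of the exponent is harmless, because
    \<open>k\<close> will be chosen freely.\<close>
  have sq: "real n powr (1/2) \<le> real m"
  proof -
    have "real n \<le> (real m)\<^sup>2"
    proof -
      have "4 \<le> m" "n \<le> 2 * m + 1" using n by (auto simp: m_def)
      then have "n \<le> m * m" using mult_le_mono1[of 4 m m] by linarith
      then show ?thesis by (metis of_nat_le_iff of_nat_mult power2_eq_square)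
    qed
    then have "sqrt (real n) \<le> real m" by (intro real_le_lsqrt) auto
    then show ?thesis using n0 by (simp add: powr_half_sqrt)
  qed
  have "D_dist (sym_group n) H \<le> (\<Sum>h\<in>H - {id}. sqrt (real (card (centralizer h)) / real (fact n)))"
    using D_dist_le[OF Hc] by (simp add: card_sym_group sym_group_one)
  also have "\<dots> \<le> (\<Sum>h\<in>H - {id}. real n powr - (real k / 4))"
  proof (rule sum_mono)
    fix h assume h: "h \<in> H - {id}"
    have hp: "h permutes {1..n}" using Hc h by (auto simp: sym_group_def)
    let ?C = "card (centralizer h)"
    have "m ^ k * ?C \<le> fact n"
      using card_centralizer_le[OF hp k m] h unfolding centralizer_sym_group by auto
    then have mC: "real m ^ k * real ?C \<le> real (fact n)"
      by (metis of_nat_le_iff of_nat_mult of_nat_power)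
    have "real n powr (real k / 2) = (real n powr (1/2)) ^ k"
      using n0 by (simp add: powr_realpow[symmetric] powr_powr)
    also have "\<dots> \<le> real m ^ k" using sq by (rule power_mono) simp
    finally have "real n powr (real k / 2) * real ?C \<le> real (fact n)"
      using mC by (meson mult_right_mono of_nat_0_le_iff order_trans)
    then have "real ?C / real (fact n) \<le> 1 / real n powr (real k / 2)"
      using n0 by (simp add: field_simps)
    also have "\<dots> = (real n powr - (real k / 4))\<^sup>2"
    proof -
      have "- (real k / 4) + - (real k / 4) = - (real k / 2)" by simp
      then show ?thesis
        unfolding power2_eq_square powr_add[symmetric] by (simp only: powr_minus inverse_eq_divide)
    qed
    finally show "sqrt (real ?C / real (fact n)) \<le> real n powr - (real k / 4)"
      by (intro real_le_lsqrt) auto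
  qed
  also have "\<dots> = real (card (H - {id})) * real n powr - (real k / 4)" by simp
  also have "\<dots> \<le> real n powr c * real n powr - (real k / 4)"
    using c card_mono[OF fH, of "H - {id}"] by (intro mult_right_mono) auto
  also have "\<dots> = real n powr (c - real k / 4)" by (simp add: powr_add[symmetric])
  finally show ?thesis .
qed

lemma ln_fact_le_square:
  assumes "n > 0"
  shows "ln (fact n) \<le> (real n)\<^sup>2"
proof -
  have "ln (fact n) \<le> ln (real n ^ n)"
    using assms fact_le_power[of n] by (subst ln_le_cancel_iff) auto
  also have "\<dots> = real n * ln (real n)" using assms by (simp add: ln_realpow)
  also have "\<dots> \<le> real n * real n" using assms ln_le_minus_one[of "real n"] by (intro mult_left_mono) auto
  finally show ?thesis by (simp add: power2_eq_square)
qed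

lemma ln_fact_ge:
  assumes "n \<ge> 16"
  shows "ln (fact n) \<ge> real n"
proof -
  have e: "exp 1 \<le> (3::real)" using exp_le by simp
  have "exp (real n) \<le> (fact n :: real)" using assms
  proof (induction n rule: nat_induct_at_least)
    case base
    have "exp (real 16) = exp 1 ^ 16" by (simp add: exp_of_nat_mult[symmetric])
    also have "\<dots> \<le> 3 ^ 16" by (rule power_mono[OF e]) simp
    also have "\<dots> \<le> (fact 16 :: real)" by (simp add: fact_numeral)
    finally show ?case .
  next
    case (Suc n)
    have "exp (real (Suc n)) = exp 1 * exp (real n)" by (simp add: exp_add mult.commute)
    also have "\<dots> \<le> real (Suc n) * fact n" using e Suc by (intro mult_mono) auto
    finally show ?case by simp
  qed
  then show ?thesis by (simp add: ln_ge_iff)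
qed

theorem theorem2:
  fixes I :: "nat set" and c :: real and H :: "nat \<Rightarrow> (nat \<Rightarrow> nat) set"
  assumes "infinite I"
    and "\<forall>n\<in>I. n > 0"
    and "c > 0"
    and "\<forall>n\<in>I. subgroup (H n) (sym_group n)"
    and "\<forall>n\<in>I. real (card (H n)) \<le> real n powr c"
  shows "distinguishable_Sym I H \<longleftrightarrow>
           (\<exists>K::nat. \<exists>N. \<forall>n\<in>I. n \<ge> N \<longrightarrow> min_degree (H n) \<le> enat K)"
proof
  assume "distinguishable_Sym I H"
  then obtain c' N where c': "c' > 0" and
    D: "\<And>n. n \<in> I \<Longrightarrow> n \<ge> N \<Longrightarrow> D_dist (sym_group n) (H n) \<ge> ln (fact n) powr - c'"
    unfolding distinguishable_Sym_def card_sym_group by auto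
  \<comment> \<open>Chosen so that \<open>c - real k / 4\<close> lies strictly below
    \<open>- (2 * c')\<close>. The resulting bound on the minimal degree is
    \<open>3 * k\<close>.\<close>
  obtain k where k: "real k > 4 * (c + 2 * c')" using reals_Archimedean2 by blast
  have "min_degree (H n) \<le> enat (3 * k)" if n: "n \<in> I" "n \<ge> max N (max (4 * k) 16)" for n
  proof (rule ccontr)
    assume "\<not> ?thesis"
    then have "enat (3 * k) \<le> min_degree (H n)" by simp
    then have "\<And>h. h \<in> H n \<Longrightarrow> h \<noteq> id \<Longrightarrow> 3 * k \<le> supp h" unfolding le_min_degree_iff by auto
    then have le: "D_dist (sym_group n) (H n) \<le> real n powr (c - real k / 4)"
      using assms n by (intro D_dist_sym_group_le) auto
    have "(real n)\<^sup>2 = real n powr 2" using n by (simp add: powr_numeral)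
    \<comment> \<open>The exponent is negative, so the upper bound n^2 for ln n! gives a lower bound
      for the threshold; this is the source of the factor 2.\<close>
    then have "real n powr - (2 * c') = ((real n)\<^sup>2) powr - c'" by (simp only: powr_powr) simp
    also have "\<dots> \<le> ln (fact n) powr - c'"
    proof (rule powr_mono2')
      show "0 < ln (fact n :: real)" using n ln_fact_ge[of n] by linarith
    qed (use c' n ln_fact_le_square[of n] in auto)
    also have "\<dots> \<le> real n powr (c - real k / 4)" using D[of n] le n by auto
    finally have "- (2 * c') \<le> c - real k / 4" using n by (subst (asm) powr_le_cancel_iff) auto
    then show False using k by simp
  qed
  then show "\<exists>K::nat. \<exists>N. \<forall>n\<in>I. n \<ge> N \<longrightarrow> min_degree (H n) \<le> enat K" by blast
next
  assume "\<exists>K::nat. \<exists>N. \<forall>n\<in>I. n \<ge> N \<longrightarrow> min_degree (H n) \<le> enat K"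
  then obtain K N where K: "\<And>n. n \<in> I \<Longrightarrow> n \<ge> N \<Longrightarrow> min_degree (H n) \<le> enat K" by blast
  have "ln (fact n) powr - (real K + c) \<le> D_dist (sym_group n) (H n)" if n: "n \<in> I" "n \<ge> max N 16" for n
  proof -
    \<comment> \<open>Passing to \<open>Suc K\<close> turns the upper bound on the infimum into the
      failure of a lower bound, which provides a nontrivial element; in particular
      \<open>H n\<close> is not trivial.\<close>
    have "\<not> enat (Suc K) \<le> min_degree (H n)" using K[of n] n by (auto dest: order_trans)
    then have "\<exists>h\<in>H n - {id}. supp h \<le> K" unfolding le_min_degree_iff not_less_eq_eq[symmetric] by blast
    then obtain h where h: "h \<in> H n" "h \<noteq> id" "supp h \<le> K" by blast
    \<comment> \<open>Here the lower bound \<open>n\<close> for ln n! is used, again with a negative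
      exponent.\<close>
    have "ln (fact n) powr - (real K + c) \<le> real n powr - (real K + c)"
      using assms(3) n ln_fact_ge[of n] by (intro powr_mono2') auto
    also have "\<dots> \<le> D_dist (sym_group n) (H n)"
      using D_dist_sym_group_ge[OF _ h] assms n by auto
    finally show ?thesis .
  qed
  moreover have "real K + c > 0" using assms(3) by simp
  ultimately show "distinguishable_Sym I H"
    unfolding distinguishable_Sym_def card_sym_group by (intro exI[of _ "real K + c"] conjI exI[of _ "max N 16"]) auto
qed

end
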